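(* Let $n$ be a positive integer, let $K$ be a real number, and let $A\subseteq \mathbb{F}_2^n$ be a nonempty set with $|A+A|\le K|A|$. Then there exists a linear subspace $V\subseteq \mathbb{F}_2^n$ with $|V|\le |A|$ such that $A$ can be covered by at most $2K^{9}$ translates of $V$.
   Context: Here $A+A=\{a+a' : a,a'\in A\}$, and a translate of $V$ is a set of the form $V+t=\{v+t: v\in V\}$ with $t\in\mathbb{F}_2^n$. *)

theory Defs
  imports "HOL-Analysis.Analysis" "HOL-Library.Z2" "HOL-Library.Set_Algebras"
begin

text \<open>
  The space \<open>\<F>\<^sub>2\<^sup>n\<close> with \<open>n \<ge> 1\<close> is the type \<^typ>\<open>bit ^ 'n\<close> with \<open>n = CARD('n)\<close>, and its linear
  subspaces are those of \<^locale>\<open>vector_space\<close> over \<^typ>\<open>bit\<close>, i.e. \<open>vec.subspace\<close>.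
  The library does not record that \<^typ>\<open>bit\<close> is finite; the following instance makes
  \<^typ>\<open>bit ^ 'n\<close> a finite type, so that \<^const>\<open>card\<close> is the true cardinality of every subset.
\<close>

instance bit :: finite
proof
  have "(UNIV :: bit set) = {0, 1}"
    by auto
  then show "finite (UNIV :: bit set)"
    by (metis finite.emptyI finite.insertI)
qed

definition is_translate :: "'a::plus set \<Rightarrow> 'a set \<Rightarrow> bool"
  where "is_translate V W \<longleftrightarrow> (\<exists>t. W = {v + t | v. v \<in> V})"

end

theory Submission
  imports Defs
begin

text \<open>
  For a distribution \<open>p\<close> on the group put \<open>\<rho>(p) = C(p) - H(p)/2\<close>, where \<open>C(p)\<close> is the infimum of
  the cross entropies of \<open>p\<close> relative to the distributions \<open>U\<^sub>A * T\<close>. Write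
  \<open>d(p, q) = H(p * q) - (H(p) + H(q))/2\<close> for the entropic Ruzsa distance and choose \<open>p\<^sub>1, p\<^sub>2\<close> that
  minimise \<open>d(p\<^sub>1, p\<^sub>2) + \<eta> (\<rho>(p\<^sub>1) + \<rho>(p\<^sub>2))\<close>. Comparing the minimum with the values at the sums,
  the fibres and the conditioned pairwise sums of four independent copies gives
  \<open>d(p\<^sub>1, p\<^sub>2) \<le> 8 \<eta> d(p\<^sub>1, p\<^sub>2)\<close>, so that \<open>d = 0\<close> if \<open>\<eta> < 1/8\<close>, and then \<open>p\<^sub>1\<close> and \<open>p\<^sub>2\<close> are
  uniform on cosets of a subgroup \<open>H\<close>. Comparing instead with \<open>p\<^sub>1 = p\<^sub>2 = U\<^sub>A\<close> and letting
  \<open>\<eta> \<rightarrow> 1/8\<close> bounds \<open>\<rho>(U\<^sub>H)\<close> by \<open>log \<bar>A\<bar> / 2 + 4 log K\<close> and hence yields a coset of \<open>H\<close> that meets \<open>A\<close> in at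
  least \<open>K\<^sup>-\<^sup>4 (\<bar>A\<bar> \<bar>H\<bar>)\<^sup>1\<^sup>/\<^sup>2\<close> points. Ruzsa's covering argument then covers \<open>A\<close> by few cosets of \<open>H\<close>,
  or of a subgroup of \<open>H\<close> if \<open>H\<close> is larger than \<open>A\<close>.
\<close>

section \<open>Entropy of random variables on a finite probability space\<close>

text \<open>The penalty must tie the minimiser to \<open>A\<close> and yet grow little under sums
  and conditioning. For independent X, Y data processing gives \<rho>(X + Y) - \<rho>(X) \<le> (H(X
  + Y) - H(X))/2, and concavity of C gives \<rho>(X | X + Y) - \<rho>(X) \<le> (H(X + Y) - H(Y))/2.
  The weight 1/2 thus makes both steps cost half an entropy increment, which the Ruzsa distances can
  absorb. Characteristic two enters through X1 + X2, X1 + X1' and X2 + X1': they add up to zero, so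
  each is the sum of the other two and a Balog-Szemeredi-Gowers argument applies to every pair. At
  \<eta> = 1/8 the resulting inequality says nothing, hence the limit. It needs no compactness,
  since there are only finitely many subgroups. The exponent is 9 = 1 + 4 + 4: one factor K from the
  covering argument, K^4 from the size of the intersection, and K^4 from the square root of the
  ratio of |A| and |H|, which lies within K^8 of 1 either way. The factor 2 is lost when H is
  replaced by a subgroup with more than |A|/2 and at most |A| elements.\<close>

class boolean_group = finite + ab_group_add +
  assumes add_self [simp]: "x + x = 0"
begin

lemma add_self_left [simp]: "x + (x + y) = y"
  by (simp flip: add.assoc)

end

instance bit :: boolean_group
  by intro_classes simp

instance vec :: (boolean_group, finite) boolean_group
  by intro_classes (simp add: vec_eq_iff)

lemma bij_add_left: "bij (\<lambda>x. x + (y::'a::boolean_group))"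
  by (rule o_bij[where g = "\<lambda>x. x + y"]) (auto simp: fun_eq_iff add.assoc)

lemma sum_shift: "(\<Sum>x\<in>UNIV. f (x + y)) = (\<Sum>x\<in>UNIV. f (x::'a::boolean_group))"
  by (rule sum.reindex_bij_betw[OF bij_add_left])

lemma sum_shift': "(\<Sum>x\<in>UNIV. f (y + x)) = (\<Sum>x\<in>UNIV. f (x::'a::boolean_group))"
  using sum_shift[of f y] by (simp add: add.commute)

text \<open>Plain real functions allow unnormalised slices of joint laws and topological arguments
  on the simplex without any conversion.\<close>

definition pdist :: "('a::finite \<Rightarrow> real) \<Rightarrow> bool"
  where "pdist p \<longleftrightarrow> (\<forall>x. 0 \<le> p x) \<and> sum p UNIV = 1"

definition law :: "('w::finite \<Rightarrow> real) \<Rightarrow> ('w \<Rightarrow> 'a) \<Rightarrow> 'a \<Rightarrow> real"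
  where "law p X x = (\<Sum>w | X w = x. p w)"

definition ent :: "('a::finite \<Rightarrow> real) \<Rightarrow> real"
  where "ent p = (\<Sum>x\<in>UNIV. - (p x * ln (p x)))"

abbreviation entropy :: "('w::finite \<Rightarrow> real) \<Rightarrow> ('w \<Rightarrow> 'a::finite) \<Rightarrow> real"
  where "entropy p X \<equiv> ent (law p X)"

lemma sum_law:
  fixes X :: "'w::finite \<Rightarrow> 'a::finite"
  shows "(\<Sum>x\<in>UNIV. law p X x * g x) = (\<Sum>w\<in>UNIV. p w * g (X w))"
proof -
  have "(\<Sum>w\<in>UNIV. p w * g (X w)) = (\<Sum>x\<in>UNIV. \<Sum>w\<in>{w\<in>UNIV. X w = x}. p w * g (X w))"
    by (rule sum.group[symmetric]) auto
  also have "\<dots> = (\<Sum>x\<in>UNIV. law p X x * g x)"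
    by (auto simp: law_def sum_distrib_right intro!: sum.cong)
  finally show ?thesis ..
qed

lemma law_comp:
  fixes X :: "'w::finite \<Rightarrow> 'a::finite"
  shows "law p (\<lambda>w. f (X w)) y = (\<Sum>x | f x = y. law p X x)"
proof -
  have "(\<Sum>x\<in>UNIV. law p X x * of_bool (f x = y)) = (\<Sum>w\<in>UNIV. p w * of_bool (f (X w) = y))"
    by (rule sum_law)
  then show ?thesis
    by (simp add: law_def of_bool_def if_distrib sum.If_cases cong: if_cong)
qed

lemma law_nonneg: "(\<And>w. 0 \<le> p w) \<Longrightarrow> 0 \<le> law p X x"
  by (simp add: law_def sum_nonneg)

lemma law_ge: "(\<And>w. 0 \<le> p w) \<Longrightarrow> p w \<le> law p X (X w)"
  unfolding law_def by (rule member_le_sum) auto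

lemma pdist_law: "pdist p \<Longrightarrow> pdist (law p X)"
  using sum_law[of p X "\<lambda>_. 1"] by (auto simp: pdist_def law_nonneg)

lemma pdist_nonneg: "pdist p \<Longrightarrow> 0 \<le> p x"
  by (simp add: pdist_def)

lemma law_mono:
  assumes "\<And>w. 0 \<le> p w" "\<And>w. X w = x \<Longrightarrow> Y w = y"
  shows "law p X x \<le> law p Y y"
  unfolding law_def using assms by (intro sum_mono2) auto

text \<open>Writing the entropy as an expectation of the information content turns Shannon identities
  into pointwise identities between logarithms.\<close>

lemma entropy_eq: "entropy p X = (\<Sum>w\<in>UNIV. p w * - ln (law p X (X w)))"
  using sum_law[of p X "\<lambda>x. - ln (law p X x)"] by (simp add: ent_def)

lemma law_cong_support:
  assumes "\<And>w. p w \<noteq> 0 \<Longrightarrow> X w = x \<longleftrightarrow> Y w = y"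
  shows "law p X x = law p Y y"
proof -
  have "law p X x = (\<Sum>w | X w = x \<and> p w \<noteq> 0. p w)"
    unfolding law_def by (rule sum.mono_neutral_right) auto
  also have "{w. X w = x \<and> p w \<noteq> 0} = {w. Y w = y \<and> p w \<noteq> 0}"
    using assms by auto
  also have "(\<Sum>w\<in>\<dots>. p w) = law p Y y"
    unfolding law_def by (rule sum.mono_neutral_left) auto
  finally show ?thesis .
qed

text \<open>Entropy sees only the partition that the variable induces on the support. A change of
  variables thus becomes an equivalence of equations, and relations that hold only almost surely may
  be used.\<close>

lemma entropy_cong_support:
  assumes "\<And>w w'. p w \<noteq> 0 \<Longrightarrow> p w' \<noteq> 0 \<Longrightarrow> X w = X w' \<longleftrightarrow> Y w = Y w'"
  shows "entropy p X = entropy p Y"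
  unfolding entropy_eq
proof (rule sum.cong[OF refl])
  fix w
  show "p w * - ln (law p X (X w)) = p w * - ln (law p Y (Y w))"
  proof (cases "p w = 0")
    case False
    then have "law p X (X w) = law p Y (Y w)"
      using assms by (intro law_cong_support) auto
    then show ?thesis by simp
  qed simp
qed

lemma entropy_recode:
  assumes "\<And>w. f (X w) = Y w" "\<And>w. g (Y w) = X w"
  shows "entropy p X = entropy p Y"
  by (rule entropy_cong_support) (metis assms)

lemma sum_law_Pair: "(\<Sum>x\<in>UNIV. law p (\<lambda>w. (X w, Z w)) (x::'a::finite, z)) = law p Z (z::'b::finite)"
proof -
  have "law p Z z = (\<Sum>u | snd u = z. law p (\<lambda>w. (X w, Z w)) u)"
    using law_comp[of p snd "\<lambda>w. (X w, Z w)" z] by simp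
  also have "\<dots> = (\<Sum>x\<in>UNIV. law p (\<lambda>w. (X w, Z w)) (x, z))"
    by (rule sum.reindex_bij_witness[where i = "\<lambda>x. (x, z)" and j = fst]) auto
  finally show ?thesis ..
qed

lemma sum_law_Pair2: "(\<Sum>z\<in>UNIV. law p (\<lambda>w. (X w, Z w)) (x, z::'b::finite)) = law p X (x::'a::finite)"
proof -
  have "law p X x = (\<Sum>u | fst u = x. law p (\<lambda>w. (X w, Z w)) u)"
    using law_comp[of p fst "\<lambda>w. (X w, Z w)" x] by simp
  also have "\<dots> = (\<Sum>z\<in>UNIV. law p (\<lambda>w. (X w, Z w)) (x, z))"
    by (rule sum.reindex_bij_witness[where i = "\<lambda>z. (x, z)" and j = snd]) auto
  finally show ?thesis ..
qed

lemma sum_UNIV_prod: "(\<Sum>u\<in>UNIV. f u) = (\<Sum>x\<in>UNIV. \<Sum>y\<in>UNIV. f (x::'a::finite, y::'b::finite))"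
  by (simp add: sum.cartesian_product flip: UNIV_Times_UNIV)

text \<open>The product rule for conditional probabilities with denominators cleared, so that null
  values of \<open>Z\<close> need no separate treatment.\<close>

definition cond_indep ::
  "('w::finite \<Rightarrow> real) \<Rightarrow> ('w \<Rightarrow> 'a) \<Rightarrow> ('w \<Rightarrow> 'b) \<Rightarrow> ('w \<Rightarrow> 'c) \<Rightarrow> bool"
  where "cond_indep p X Y Z \<longleftrightarrow> (\<forall>x y z.
    law p (\<lambda>w. (X w, Y w, Z w)) (x, y, z) * law p Z z =
    law p (\<lambda>w. (X w, Z w)) (x, z) * law p (\<lambda>w. (Y w, Z w)) (y, z))"

lemma entropy_cond_indep:
  fixes X :: "'w::finite \<Rightarrow> 'a::finite" and Y :: "'w \<Rightarrow> 'b::finite" and Z :: "'w \<Rightarrow> 'c::finite"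
  assumes p: "\<And>w. 0 \<le> p w" and "cond_indep p X Y Z"
  shows "entropy p (\<lambda>w. (X w, Y w, Z w)) + entropy p Z =
    entropy p (\<lambda>w. (X w, Z w)) + entropy p (\<lambda>w. (Y w, Z w))"
  unfolding entropy_eq sum.distrib[symmetric]
proof (rule sum.cong[OF refl])
  fix w
  let ?a = "law p (\<lambda>w. (X w, Y w, Z w)) (X w, Y w, Z w)" and ?b = "law p Z (Z w)"
  let ?c = "law p (\<lambda>w. (X w, Z w)) (X w, Z w)" and ?d = "law p (\<lambda>w. (Y w, Z w)) (Y w, Z w)"
  show "p w * - ln ?a + p w * - ln ?b = p w * - ln ?c + p w * - ln ?d"
  proof (cases "p w = 0")
    case False
    then have "0 < p w" using p[of w] by simp
    then have pos: "0 < ?a" "0 < ?b" "0 < ?c" "0 < ?d"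
      by (auto intro!: order.strict_trans2[OF _ law_ge] p)
    have "?a * ?b = ?c * ?d" using assms(2) unfolding cond_indep_def by blast
    then have "ln ?a + ln ?b = ln ?c + ln ?d"
      by (simp only: ln_mult_pos[OF pos(1,2), symmetric] ln_mult_pos[OF pos(3,4), symmetric])
    then have "p w * (ln ?a + ln ?b) = p w * (ln ?c + ln ?d)" by simp
    then show ?thesis by (simp add: algebra_simps)
  qed simp
qed

text \<open>This is I(X : Y | Z) \<ge> 0. It follows from ln r \<le> r - 1, where r is the ratio of
  the conditionally independent joint law to the true one, because the integral of r is at most the
  total mass.\<close>

lemma entropy_submodular:
  fixes X :: "'w::finite \<Rightarrow> 'a::finite" and Y :: "'w \<Rightarrow> 'b::finite" and Z :: "'w \<Rightarrow> 'c::finite"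
  assumes p: "\<And>w. 0 \<le> p w"
  shows "entropy p (\<lambda>w. (X w, Y w, Z w)) + entropy p Z \<le>
    entropy p (\<lambda>w. (X w, Z w)) + entropy p (\<lambda>w. (Y w, Z w))"
proof -
  let ?a = "law p (\<lambda>w. (X w, Y w, Z w))" and ?b = "law p Z"
  let ?c = "law p (\<lambda>w. (X w, Z w))" and ?d = "law p (\<lambda>w. (Y w, Z w))"
  \<comment> \<open>The value 0 off the support of the joint law is safe: only the support
    contributes to the expectation, and an upper bound is enough.\<close>
  define r where "r = (\<lambda>(x, y, z). if ?a (x, y, z) = 0 then 0 else ?c (x, z) * ?d (y, z) / (?a (x, y, z) * ?b z))"
  have nn: "0 \<le> ?a u" "0 \<le> ?b z" "0 \<le> ?c v" "0 \<le> ?d v'" for u z v v'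
    using p by (auto intro: law_nonneg)
  have "?a u * r u \<le> ?c (fst u, snd (snd u)) * ?d (snd u) / ?b (snd (snd u))" for u
    using nn by (cases u) (auto simp: r_def)
  then have "(\<Sum>u\<in>UNIV. ?a u * r u) \<le> (\<Sum>u\<in>UNIV. ?c (fst u, snd (snd u)) * ?d (snd u) / ?b (snd (snd u)))"
    by (rule sum_mono)
  also have "\<dots> = (\<Sum>v\<in>UNIV. \<Sum>x\<in>UNIV. ?c (x, snd v) * ?d v / ?b (snd v))"
    by (subst sum_UNIV_prod, subst sum.swap) simp
  also have "\<dots> = (\<Sum>v\<in>UNIV. ?b (snd v) * ?d v / ?b (snd v))"
    by (intro sum.cong refl) (simp add: sum_law_Pair flip: sum_distrib_right sum_divide_distrib)
  also have "\<dots> \<le> (\<Sum>v\<in>UNIV. ?d v)"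
    using nn by (intro sum_mono) auto
  also have "\<dots> = (\<Sum>w\<in>UNIV. p w)"
    using sum_law[of p "\<lambda>w. (Y w, Z w)" "\<lambda>_. 1"] by simp
  finally have le: "(\<Sum>w\<in>UNIV. p w * r (X w, Y w, Z w)) \<le> (\<Sum>w\<in>UNIV. p w)"
    by (simp add: sum_law)
  have "p w * - ln (?a (X w, Y w, Z w)) + p w * - ln (?b (Z w)) + p w \<le>
    p w * - ln (?c (X w, Z w)) + p w * - ln (?d (Y w, Z w)) + p w * r (X w, Y w, Z w)" for w
  proof (cases "p w = 0")
    case False
    then have "0 < p w" using p[of w] by simp
    then have pos: "0 < ?a (X w, Y w, Z w)" "0 < ?b (Z w)" "0 < ?c (X w, Z w)" "0 < ?d (Y w, Z w)"
      by (auto intro!: order.strict_trans2[OF _ law_ge] p)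
    have "ln (r (X w, Y w, Z w)) \<le> r (X w, Y w, Z w) - 1"
      using pos by (intro ln_le_minus_one) (simp add: r_def)
    also have "ln (r (X w, Y w, Z w)) = ln (?c (X w, Z w)) + ln (?d (Y w, Z w))
        - ln (?a (X w, Y w, Z w)) - ln (?b (Z w))"
      using pos by (simp add: r_def ln_div ln_mult)
    finally have "- ln (?a (X w, Y w, Z w)) - ln (?b (Z w)) + 1 \<le>
      - ln (?c (X w, Z w)) - ln (?d (Y w, Z w)) + r (X w, Y w, Z w)" by simp
    from mult_left_mono[OF this, of "p w"] p[of w] show ?thesis
      by (simp add: algebra_simps)
  qed simp
  then have "(\<Sum>w\<in>UNIV. p w * - ln (?a (X w, Y w, Z w)) + p w * - ln (?b (Z w)) + p w) \<le>
    (\<Sum>w\<in>UNIV. p w * - ln (?c (X w, Z w)) + p w * - ln (?d (Y w, Z w)) + p w * r (X w, Y w, Z w))"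
    by (intro sum_mono)
  with le show ?thesis
    unfolding entropy_eq sum.distrib by linarith
qed

section \<open>Convolutions and functionals compatible with them\<close>

text \<open>Every element is its own negative, so \<open>x + y\<close> is the difference of the
  usual formula.\<close>

definition conv :: "('a::boolean_group \<Rightarrow> real) \<Rightarrow> ('a \<Rightarrow> real) \<Rightarrow> 'a \<Rightarrow> real"
  where "conv p q x = (\<Sum>y\<in>UNIV. p y * q (x + y))"

lemma conv_nonneg: "(\<And>x. 0 \<le> p x) \<Longrightarrow> (\<And>x. 0 \<le> q x) \<Longrightarrow> 0 \<le> conv p q x"
  by (simp add: conv_def sum_nonneg)

lemma conv_commute: "conv p q = conv q p"
proof
  fix x
  have "conv p q x = (\<Sum>y\<in>UNIV. p (y + x) * q (x + (y + x)))"
    unfolding conv_def by (rule sum_shift[symmetric])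
  then show "conv p q x = conv q p x"
    by (simp add: conv_def ac_simps)
qed

lemma sum_conv: "sum (conv p q) UNIV = sum p UNIV * sum q UNIV"
proof -
  have "sum (conv p q) UNIV = (\<Sum>y\<in>UNIV. p y * (\<Sum>x\<in>UNIV. q (x + y)))"
    unfolding conv_def by (subst sum.swap) (simp add: sum_distrib_left)
  then show ?thesis by (simp add: sum_shift sum_distrib_right)
qed

lemma pdist_conv: "pdist p \<Longrightarrow> pdist q \<Longrightarrow> pdist (conv p q)"
  by (auto simp: pdist_def conv_nonneg sum_conv)

lemma law_add_Pair:
  fixes X Y :: "'w::finite \<Rightarrow> 'a::boolean_group" and Z :: "'w \<Rightarrow> 'c::finite"
  shows "law p (\<lambda>w. (X w + Y w, Z w)) (u, z) =
    (\<Sum>x\<in>UNIV. law p (\<lambda>w. (X w, Y w, Z w)) (x, u + x, z))"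
proof -
  have "law p (\<lambda>w. (X w + Y w, Z w)) (u, z) =
      (\<Sum>v | (\<lambda>(x, y, z). (x + y, z)) v = (u, z). law p (\<lambda>w. (X w, Y w, Z w)) v)"
    using law_comp[of p "\<lambda>(x, y, z). (x + y, z)" "\<lambda>w. (X w, Y w, Z w)" "(u, z)"] by simp
  also have "\<dots> = (\<Sum>x\<in>UNIV. law p (\<lambda>w. (X w, Y w, Z w)) (x, u + x, z))"
    by (rule sum.reindex_bij_witness[where i = "\<lambda>x. (x, u + x, z)" and j = fst])
      (auto simp: ac_simps)
  finally show ?thesis .
qed

definition cond_law :: "('w::finite \<Rightarrow> real) \<Rightarrow> ('w \<Rightarrow> 'a) \<Rightarrow> ('w \<Rightarrow> 'c) \<Rightarrow> 'c \<Rightarrow> 'a \<Rightarrow> real"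
  where "cond_law p X Z z x = law p (\<lambda>w. (X w, Z w)) (x, z) / law p Z z"

lemma law_Pair_eq_0:
  assumes "\<And>w. 0 \<le> p w" "law p Z z = 0"
  shows "law p (\<lambda>w. (X w, Z w)) (x, z) = 0"
  using law_mono[of p "\<lambda>w. (X w, Z w)" "(x, z)" Z z] law_nonneg[of p "\<lambda>w. (X w, Z w)" "(x, z)", OF assms(1)]
    assms by auto

lemma law_Pair_eq_cond_law:
  assumes "\<And>w. 0 \<le> p w"
  shows "law p (\<lambda>w. (X w, Z w)) (x, z) = law p Z z * cond_law p X Z z x"
  using law_Pair_eq_0[of p Z z X x, OF assms] by (auto simp: cond_law_def)

lemma pdist_cond_law:
  fixes X :: "'w::finite \<Rightarrow> 'a::finite" and Z :: "'w \<Rightarrow> 'c::finite"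
  assumes "\<And>w. 0 \<le> p w" "law p Z z \<noteq> 0"
  shows "pdist (cond_law p X Z z)"
  using assms by (auto simp: pdist_def cond_law_def law_nonneg sum_law_Pair simp flip: sum_divide_distrib)

lemma law_add_cond_indep:
  fixes X Y :: "'w::finite \<Rightarrow> 'a::boolean_group" and Z :: "'w \<Rightarrow> 'c::finite"
  assumes p: "\<And>w. 0 \<le> p w" and "cond_indep p X Y Z"
  shows "law p (\<lambda>w. (X w + Y w, Z w)) (u, z) =
    conv (\<lambda>x. law p (\<lambda>w. (X w, Z w)) (x, z)) (cond_law p Y Z z) u"
proof (cases "law p Z z = 0")
  case True
  then show ?thesis by (simp add: law_Pair_eq_0[OF p True] conv_def)
next
  case False
  then show ?thesis
    using assms(2) unfolding law_add_Pair conv_def cond_indep_def cond_law_def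
    by (intro sum.cong refl) (simp add: field_simps)
qed

lemma entropy_Pair_slices:
  fixes X :: "'w::finite \<Rightarrow> 'a::finite" and Z :: "'w \<Rightarrow> 'c::finite"
  shows "entropy p (\<lambda>w. (X w, Z w)) = (\<Sum>z\<in>UNIV. ent (\<lambda>x. law p (\<lambda>w. (X w, Z w)) (x, z)))"
  unfolding ent_def sum_UNIV_prod by (rule sum.swap)

lemma ent_scale:
  assumes "0 \<le> c" "\<And>x. 0 \<le> m x"
  shows "ent (\<lambda>x. c * m x) = c * ent m - c * ln c * sum m UNIV"
proof -
  have "- (c * m x * ln (c * m x)) = c * - (m x * ln (m x)) - c * ln c * m x" for x
  proof (cases "c = 0 \<or> m x = 0")
    case False
    then show ?thesis using assms less_eq_real_def by (auto simp: ln_mult algebra_simps)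
  qed auto
  then show ?thesis
    by (simp add: ent_def sum_subtractf sum_distrib_left)
qed

text \<open>
  \<open>C\<close> is defined on all nonnegative functions, homogeneously, so that averages over conditional
  distributions become plain sums over the slices of a joint distribution; in this form
  superadditivity expresses concavity. The last axiom is the data processing inequality.
\<close>

locale conv_functional =
  fixes C :: "('a::boolean_group \<Rightarrow> real) \<Rightarrow> real"
  assumes C_scale: "\<And>m c. (\<And>x. 0 \<le> m x) \<Longrightarrow> 0 \<le> c \<Longrightarrow> C (\<lambda>x. c * m x) = c * C m"
    and C_add: "\<And>m m'. (\<And>x. 0 \<le> m x) \<Longrightarrow> (\<And>x. 0 \<le> m' x) \<Longrightarrow> C m + C m' \<le> C (\<lambda>x. m x + m' x)"
    and C_conv: "\<And>m r. (\<And>x. 0 \<le> m x) \<Longrightarrow> pdist r \<Longrightarrow> C (conv m r) - ent (conv m r) \<le> C m - ent m"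
begin

lemma C_zero: "C (\<lambda>_. 0) = 0"
  using C_scale[of "\<lambda>_. 0" 0] by simp

lemma C_sum:
  assumes "finite I" "\<And>i x. 0 \<le> m i x"
  shows "(\<Sum>i\<in>I. C (m i)) \<le> C (\<lambda>x. \<Sum>i\<in>I. m i x)"
  using assms(1)
proof induction
  case (insert i I)
  have "C (m i) + C (\<lambda>x. \<Sum>i\<in>I. m i x) \<le> C (\<lambda>x. m i x + (\<Sum>i\<in>I. m i x))"
    by (rule C_add) (simp_all add: assms sum_nonneg)
  with insert show ?case by simp
qed (simp add: C_zero)

text \<open>In the usual notation this is C(X | Z).\<close>

definition CC :: "('w::finite \<Rightarrow> real) \<Rightarrow> ('w \<Rightarrow> 'a) \<Rightarrow> ('w \<Rightarrow> 'c::finite) \<Rightarrow> real"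
  where "CC p X Z = (\<Sum>z\<in>UNIV. C (\<lambda>x. law p (\<lambda>w. (X w, Z w)) (x, z)))"

lemma CC_le_C:
  assumes "\<And>w. 0 \<le> p w"
  shows "CC p X Z \<le> C (law p X)"
  using C_sum[of UNIV "\<lambda>z x. law p (\<lambda>w. (X w, Z w)) (x, z)"] assms
  by (simp add: CC_def law_nonneg sum_law_Pair2)

text \<open>A coarser condition merges slices, and by superadditivity merging can only increase the
  total of C.\<close>

lemma CC_mono:
  fixes Z' :: "'w::finite \<Rightarrow> 'd::finite" and Z :: "'w \<Rightarrow> 'c::finite"
  assumes "\<And>w. 0 \<le> p w" "\<And>w. Z w = f (Z' w)"
  shows "CC p X Z' \<le> CC p X Z"
proof -
  have *: "law p (\<lambda>w. (X w, Z w)) (x, z) = (\<Sum>z' | f z' = z. law p (\<lambda>w. (X w, Z' w)) (x, z'))" for x z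
  proof -
    have "law p (\<lambda>w. (X w, Z w)) (x, z) =
        (\<Sum>v | (\<lambda>(x, z). (x, f z)) v = (x, z). law p (\<lambda>w. (X w, Z' w)) v)"
      using law_comp[of p "\<lambda>(x, z). (x, f z)" "\<lambda>w. (X w, Z' w)" "(x, z)"] by (simp add: assms)
    also have "\<dots> = (\<Sum>z' | f z' = z. law p (\<lambda>w. (X w, Z' w)) (x, z'))"
      by (rule sum.reindex_bij_witness[where i = "\<lambda>z. (x, z)" and j = snd]) auto
    finally show ?thesis .
  qed
  have "CC p X Z' = (\<Sum>z\<in>UNIV. \<Sum>z' | f z' = z. C (\<lambda>x. law p (\<lambda>w. (X w, Z' w)) (x, z')))"
    unfolding CC_def using sum.group[of UNIV UNIV f "\<lambda>z'. C (\<lambda>x. law p (\<lambda>w. (X w, Z' w)) (x, z'))"]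
    by simp
  also have "\<dots> \<le> CC p X Z"
    unfolding CC_def * by (intro sum_mono C_sum) (simp_all add: assms law_nonneg)
  finally show ?thesis .
qed

text \<open>On each slice the law of the sum is a convolution with the conditional law of
  \<open>Y\<close>, so data processing applies slice by slice.\<close>

lemma CC_add_cond_indep:
  fixes X Y :: "'w::finite \<Rightarrow> 'a" and Z :: "'w \<Rightarrow> 'c::finite"
  assumes p: "\<And>w. 0 \<le> p w" and ci: "cond_indep p X Y Z"
  shows "CC p (\<lambda>w. X w + Y w) Z - entropy p (\<lambda>w. (X w + Y w, Z w)) \<le> CC p X Z - entropy p (\<lambda>w. (X w, Z w))"
  unfolding CC_def entropy_Pair_slices sum_subtractf[symmetric]
proof (rule sum_mono)
  fix z
  let ?k = "\<lambda>x. law p (\<lambda>w. (X w + Y w, Z w)) (x, z)" and ?m = "\<lambda>x. law p (\<lambda>w. (X w, Z w)) (x, z)"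
  show "C ?k - ent ?k \<le> C ?m - ent ?m"
  proof (cases "law p Z z = 0")
    case True
    then have "?k = ?m" by (simp add: law_Pair_eq_0 p)
    then show ?thesis by simp
  next
    case False
    have "?k = conv ?m (cond_law p Y Z z)"
      using law_add_cond_indep[OF p ci] by blast
    then show ?thesis
      using C_conv[of ?m "cond_law p Y Z z"] pdist_cond_law[of p Z z Y, OF p False] by (simp add: law_nonneg p)
  qed
qed

text \<open>Given \<open>Z\<close> the summand \<open>f (Z w)\<close> is constant, hence
  conditionally independent of \<open>X\<close>, and adding it leaves the joint entropy unchanged.
  Data processing then compares the C terms alone; as the shift is an involution, a second
  application gives equality.\<close>

lemma CC_add_fun_le:
  fixes X :: "'w::finite \<Rightarrow> 'a" and Z :: "'w \<Rightarrow> 'c::finite"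
  assumes p: "\<And>w. 0 \<le> p w"
  shows "CC p (\<lambda>w. X w + f (Z w)) Z \<le> CC p X Z"
proof -
  have 1: "law p (\<lambda>w. (f (Z w), Z w)) (y, z) = (if f z = y then law p Z z else 0)" for y z
    by (auto simp: law_def intro!: sum.cong sum.neutral)
  have 2: "law p (\<lambda>w. (X w, f (Z w), Z w)) (x, y, z) = (if f z = y then law p (\<lambda>w. (X w, Z w)) (x, z) else 0)" for x y z
    by (auto simp: law_def intro!: sum.cong sum.neutral)
  have "cond_indep p X (\<lambda>w. f (Z w)) Z"
    by (simp add: cond_indep_def 1 2)
  from CC_add_cond_indep[OF p this]
  have "CC p (\<lambda>w. X w + f (Z w)) Z - entropy p (\<lambda>w. (X w + f (Z w), Z w)) \<le> CC p X Z - entropy p (\<lambda>w. (X w, Z w))" .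
  moreover have "entropy p (\<lambda>w. (X w + f (Z w), Z w)) = entropy p (\<lambda>w. (X w, Z w))"
    by (rule entropy_cong_support) auto
  ultimately show ?thesis by simp
qed

lemma CC_add_fun:
  fixes X :: "'w::finite \<Rightarrow> 'a" and Z :: "'w \<Rightarrow> 'c::finite"
  assumes p: "\<And>w. 0 \<le> p w"
  shows "CC p (\<lambda>w. X w + f (Z w)) Z = CC p X Z"
  using CC_add_fun_le[of p X f Z, OF p] CC_add_fun_le[of p "\<lambda>w. X w + f (Z w)" f Z, OF p]
  by (simp add: add.assoc)

end

text \<open>Only the lower bound is recorded here; that it is attained enters as an equation in
  \<open>doubling_zero\<close>.\<close>

locale minimal_value = conv_functional C for C :: "('a::boolean_group \<Rightarrow> real) \<Rightarrow> real" +
  fixes \<eta> \<Phi> :: real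
  assumes \<Phi>_le: "\<And>q r. pdist q \<Longrightarrow> pdist r \<Longrightarrow>
    \<Phi> \<le> ent (conv q r) - (1 + \<eta>) / 2 * (ent q + ent r) + \<eta> * (C q + C r)"
begin

text \<open>Minimality survives conditioning: the bound is applied to the conditional laws for each
  z and averaged with weights P(z). Each unnormalised slice changes its entropy by P(z) ln P(z), and
  these corrections add up to multiples of \<open>entropy p Z\<close>.\<close>

lemma \<Phi>_le_cond:
  fixes X Y :: "'w::finite \<Rightarrow> 'a" and Z :: "'w \<Rightarrow> 'c::finite"
  assumes p: "pdist p" and ci: "cond_indep p X Y Z"
  shows "\<Phi> \<le> (entropy p (\<lambda>w. (X w + Y w, Z w)) - entropy p Z)
    - (1 + \<eta>) / 2 * (entropy p (\<lambda>w. (X w, Z w)) + entropy p (\<lambda>w. (Y w, Z w)) - 2 * entropy p Z)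
    + \<eta> * (CC p X Z + CC p Y Z)"
proof -
  note nn = pdist_nonneg[OF p]
  let ?P = "law p Z"
  let ?k = "\<lambda>z x. law p (\<lambda>w. (X w + Y w, Z w)) (x, z)"
  let ?m = "\<lambda>z x. law p (\<lambda>w. (X w, Z w)) (x, z)" and ?n = "\<lambda>z x. law p (\<lambda>w. (Y w, Z w)) (x, z)"
  have step: "?P z * \<Phi> \<le> ent (?k z) + ?P z * ln (?P z)
      - (1 + \<eta>) / 2 * (ent (?m z) + ent (?n z) + 2 * (?P z * ln (?P z))) + \<eta> * (C (?m z) + C (?n z))" for z
  proof (cases "?P z = 0")
    case True
    then show ?thesis by (simp add: law_Pair_eq_0[OF nn True] C_zero ent_def)
  next
    case False
    then have P: "0 < ?P z" using law_nonneg[of p Z z] nn by (simp add: less_le)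
    let ?M = "cond_law p X Z z" and ?N = "cond_law p Y Z z"
    have M: "pdist ?M" and N: "pdist ?N" using pdist_cond_law[of p, OF nn False] by blast+
    have m: "?m z = (\<lambda>x. ?P z * ?M x)" and n: "?n z = (\<lambda>x. ?P z * ?N x)"
      by (intro ext law_Pair_eq_cond_law nn)+
    have k: "?k z = (\<lambda>x. ?P z * conv ?M ?N x)"
      by (simp add: law_add_cond_indep[of p X Y Z, OF nn ci] conv_def sum_distrib_left mult.assoc
          law_Pair_eq_cond_law[of p X Z, OF nn])
    have ent: "ent (\<lambda>x. ?P z * q x) = ?P z * ent q - ?P z * ln (?P z)" if "pdist q" for q :: "'a \<Rightarrow> real"
      using that P by (subst ent_scale) (auto simp: pdist_def)
    have C: "C (\<lambda>x. ?P z * q x) = ?P z * C q" if "pdist q" for q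
      using that P by (subst C_scale) (auto simp: pdist_def)
    have "?P z * \<Phi> \<le> ?P z * (ent (conv ?M ?N) - (1 + \<eta>) / 2 * (ent ?M + ent ?N) + \<eta> * (C ?M + C ?N))"
      using P \<Phi>_le[OF M N] by (intro mult_left_mono) auto
    then show ?thesis
      unfolding m n k ent[OF M] ent[OF N] ent[OF pdist_conv[OF M N]] C[OF M] C[OF N]
      by (simp add: algebra_simps)
  qed
  have "\<Phi> = (\<Sum>z\<in>UNIV. ?P z * \<Phi>)"
    using pdist_law[OF p, of Z] by (simp add: pdist_def flip: sum_distrib_right)
  also have "\<dots> \<le> (\<Sum>z\<in>UNIV. ent (?k z) + ?P z * ln (?P z)
      - (1 + \<eta>) / 2 * (ent (?m z) + ent (?n z) + 2 * (?P z * ln (?P z))) + \<eta> * (C (?m z) + C (?n z)))"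
    by (rule sum_mono) (rule step)
  also have "\<dots> = (entropy p (\<lambda>w. (X w + Y w, Z w)) - entropy p Z)
    - (1 + \<eta>) / 2 * (entropy p (\<lambda>w. (X w, Z w)) + entropy p (\<lambda>w. (Y w, Z w)) - 2 * entropy p Z)
    + \<eta> * (CC p X Z + CC p Y Z)"
    unfolding entropy_Pair_slices CC_def ent_def[of "law p Z"]
    by (simp only: sum.distrib sum_subtractf sum_negf sum_distrib_left[symmetric]) simp
  finally show ?thesis .
qed

end

section \<open>Conditionally independent copies\<close>

text \<open>For nonnegative \<open>p\<close>, if \<open>law p Z (Z w)\<close> is 0 then so is
  \<open>p w\<close>, so the convention x / 0 = 0 yields the correct weight.\<close>

definition coupling :: "('w::finite \<Rightarrow> real) \<Rightarrow> ('w \<Rightarrow> 'c) \<Rightarrow> 'w \<times> 'w \<Rightarrow> real"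
  where "coupling p Z = (\<lambda>(w, w'). if Z w = Z w' then p w * p w' / law p Z (Z w) else 0)"

lemma coupling_nonneg: "(\<And>w. 0 \<le> p w) \<Longrightarrow> 0 \<le> coupling p Z u"
  by (auto simp: coupling_def law_nonneg split: prod.split)

lemma coupling_support: "coupling p Z u \<noteq> 0 \<Longrightarrow> Z (fst u) = Z (snd u)"
  by (cases u) (auto simp: coupling_def split: if_splits)

lemma law_coupling_fst:
  fixes X :: "'w::finite \<Rightarrow> 'a::finite" and Z :: "'w \<Rightarrow> 'c::finite"
  assumes p: "\<And>w. 0 \<le> p w"
  shows "law (coupling p Z) (\<lambda>u. X (fst u)) = law p X"
proof -
  have "law (coupling p Z) fst w = p w" for w
  proof -
    have "law (coupling p Z) fst w = (\<Sum>w'\<in>UNIV. coupling p Z (w, w'))"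
      unfolding law_def by (rule sum.reindex_bij_witness[where i = "\<lambda>w'. (w, w')" and j = snd]) auto
    also have "\<dots> = (\<Sum>w' | Z w' = Z w. p w * p w' / law p Z (Z w))"
      by (rule sum.mono_neutral_cong_right) (auto simp: coupling_def)
    also have "\<dots> = p w * law p Z (Z w) / law p Z (Z w)"
      by (simp add: law_def sum_distrib_left sum_divide_distrib)
    also have "\<dots> = p w"
      using law_ge[of p w Z, OF p] p[of w] by auto
    finally show ?thesis .
  qed
  then show ?thesis
    using law_comp[of "coupling p Z" X fst] by (auto simp: law_def[of p X])
qed

lemma law_coupling_snd:
  fixes X :: "'w::finite \<Rightarrow> 'a::finite" and Z :: "'w \<Rightarrow> 'c::finite"
  assumes p: "\<And>w. 0 \<le> p w"
  shows "law (coupling p Z) (\<lambda>u. X (snd u)) = law p X"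
proof -
  have "law (coupling p Z) (\<lambda>u. X (snd u)) = law (coupling p Z) (\<lambda>u. X (fst u))"
    unfolding law_def
    by (intro ext sum.reindex_bij_witness[where i = prod.swap and j = prod.swap])
      (auto simp: coupling_def mult.commute)
  with law_coupling_fst[of p Z X, OF p] show ?thesis by simp
qed

lemma law_of_bool: "law p X x = (\<Sum>w\<in>UNIV. of_bool (X w = x) * p w)"
  by (simp add: law_def of_bool_def if_distrib if_distribR sum.If_cases cong: if_cong)

lemma cond_indep_coupling:
  fixes X :: "'w::finite \<Rightarrow> 'a::finite" and Y :: "'w \<Rightarrow> 'b::finite" and Z :: "'w \<Rightarrow> 'c::finite"
  assumes p: "\<And>w. 0 \<le> p w"
  shows "cond_indep (coupling p Z) (\<lambda>u. X (fst u)) (\<lambda>u. Y (snd u)) (\<lambda>u. Z (fst u))"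
proof -
  let ?q = "coupling p Z"
  have triple: "law ?q (\<lambda>u. (X (fst u), Y (snd u), Z (fst u))) (x, y, z) =
      law p (\<lambda>w. (X w, Z w)) (x, z) * law p (\<lambda>w. (Y w, Z w)) (y, z) / law p Z z" for x y z
  proof -
    have "law ?q (\<lambda>u. (X (fst u), Y (snd u), Z (fst u))) (x, y, z) =
        (\<Sum>w\<in>UNIV. \<Sum>w'\<in>UNIV. of_bool ((X w, Y w', Z w) = (x, y, z)) * ?q (w, w'))"
      unfolding law_of_bool by (subst sum_UNIV_prod) simp
    also have "\<dots> = (\<Sum>w\<in>UNIV. \<Sum>w'\<in>UNIV.
        (of_bool ((X w, Z w) = (x, z)) * p w) * (of_bool ((Y w', Z w') = (y, z)) * p w') / law p Z z)"
      by (intro sum.cong refl) (auto simp: coupling_def)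
    finally show ?thesis
      by (simp only: law_of_bool[of p "\<lambda>w. (X w, Z w)"] law_of_bool[of p "\<lambda>w. (Y w, Z w)"]
          sum_product sum_divide_distrib)
  qed
  have 1: "law ?q (\<lambda>u. (X (fst u), Z (fst u))) = law p (\<lambda>w. (X w, Z w))"
    using law_coupling_fst[of p Z "\<lambda>w. (X w, Z w)", OF p] by simp
  have 2: "law ?q (\<lambda>u. (Y (snd u), Z (fst u))) (y, z) = law p (\<lambda>w. (Y w, Z w)) (y, z)" for y z
  proof -
    have "law ?q (\<lambda>u. (Y (snd u), Z (fst u))) (y, z) = law ?q (\<lambda>u. (Y (snd u), Z (snd u))) (y, z)"
      by (rule law_cong_support) (auto dest: coupling_support)
    then show ?thesis
      using law_coupling_snd[of p Z "\<lambda>w. (Y w, Z w)", OF p] by simp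
  qed
  show ?thesis
    unfolding cond_indep_def triple 1 2 law_coupling_fst[of p Z Z, OF p]
  proof (intro allI)
    fix x y z
    show "law p (\<lambda>w. (X w, Z w)) (x, z) * law p (\<lambda>w. (Y w, Z w)) (y, z) / law p Z z * law p Z z =
      law p (\<lambda>w. (X w, Z w)) (x, z) * law p (\<lambda>w. (Y w, Z w)) (y, z)"
      using law_Pair_eq_0[of p Z z X x, OF p] by (cases "law p Z z = 0") simp_all
  qed
qed

context minimal_value
begin

text \<open>The conditional Balog--Szemeredi--Gowers inequality: two copies of \<open>(A, B)\<close> that are independent
  given \<open>Z = (A + B, S)\<close> satisfy \<open>A\<^sub>1 + B\<^sub>1 = A\<^sub>2 + B\<^sub>2\<close>, so that \<open>A\<^sub>1 + B\<^sub>2 = A\<^sub>2 + B\<^sub>1\<close> is a function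
  of \<open>(A\<^sub>1, B\<^sub>2)\<close> as well as of \<open>(A\<^sub>2, B\<^sub>1)\<close>.\<close>

lemma \<Phi>_le_dependent:
  fixes A B :: "'w::finite \<Rightarrow> 'a" and S :: "'w \<Rightarrow> 'c::finite"
  assumes p: "pdist p"
  defines "HS \<equiv> entropy p S" and "HA \<equiv> entropy p (\<lambda>w. (A w, S w))"
    and "HB \<equiv> entropy p (\<lambda>w. (B w, S w))" and "HAB \<equiv> entropy p (\<lambda>w. (A w, B w, S w))"
    and "HC \<equiv> entropy p (\<lambda>w. (A w + B w, S w))"
  shows "\<Phi> \<le> 2 * HA + 2 * HB - 3 * HS - 2 * HAB + HC - (1 + \<eta>) * (HAB - HC)
    + \<eta> * (CC p A (\<lambda>w. (A w + B w, S w)) + CC p B (\<lambda>w. (A w + B w, S w)))"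
proof -
  note nn = pdist_nonneg[OF p]
  define Z where "Z = (\<lambda>w. (A w + B w, S w))"
  define q where "q = coupling p Z"
  have q0: "0 \<le> q u" for u unfolding q_def by (rule coupling_nonneg) (rule nn)
  have supp: "A (snd u) + B (snd u) = A (fst u) + B (fst u) \<and> S (snd u) = S (fst u)" if "q u \<noteq> 0" for u
    using coupling_support[of p Z u] that by (auto simp: q_def Z_def)
  have law1: "law q (\<lambda>u. X (fst u)) = law p X" for X :: "'w \<Rightarrow> 'd::finite"
    unfolding q_def by (rule law_coupling_fst) (rule nn)
  have law2: "law q (\<lambda>u. X (snd u)) = law p X" for X :: "'w \<Rightarrow> 'd::finite"
    unfolding q_def by (rule law_coupling_snd) (rule nn)
  have pq: "pdist q"
  proof -
    have "pdist (law q (\<lambda>u. fst u))" unfolding law1[of "\<lambda>w. w"] by (rule pdist_law[OF p])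
    then show ?thesis
      using q0 sum_law[of q "\<lambda>u. fst u" "\<lambda>_. 1"] by (simp add: pdist_def)
  qed
  have Z2: "law q (\<lambda>u. (X (snd u), Z (fst u))) = law p (\<lambda>w. (X w, Z w))" for X :: "'w \<Rightarrow> 'd::finite"
  proof
    fix v
    have "law q (\<lambda>u. (X (snd u), Z (fst u))) v = law q (\<lambda>u. (X (snd u), Z (snd u))) v"
      by (rule law_cong_support) (auto dest: supp simp: Z_def)
    then show "law q (\<lambda>u. (X (snd u), Z (fst u))) v = law p (\<lambda>w. (X w, Z w)) v"
      using law2[of "\<lambda>w. (X w, Z w)"] by simp
  qed
  let ?A1 = "\<lambda>u. A (fst u)" and ?B1 = "\<lambda>u. B (fst u)" and ?A2 = "\<lambda>u. A (snd u)"
  let ?B2 = "\<lambda>u. B (snd u)" and ?S1 = "\<lambda>u. S (fst u)" and ?Z1 = "\<lambda>u. Z (fst u)"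
  let ?D = "\<lambda>u. ?A1 u + ?B2 u"
  have S2: "law q (\<lambda>u. (X (snd u), S (fst u))) = law p (\<lambda>w. (X w, S w))" for X :: "'w \<Rightarrow> 'd::finite"
  proof
    fix v
    have "law q (\<lambda>u. (X (snd u), S (fst u))) v = law q (\<lambda>u. (X (snd u), S (snd u))) v"
      by (rule law_cong_support) (auto dest: supp)
    then show "law q (\<lambda>u. (X (snd u), S (fst u))) v = law p (\<lambda>w. (X w, S w)) v"
      using law2[of "\<lambda>w. (X w, S w)"] by simp
  qed
  have main: "\<Phi> \<le> (entropy q (\<lambda>u. (?D u, ?Z1 u)) - entropy q ?Z1)
    - (1 + \<eta>) / 2 * (entropy q (\<lambda>u. (?A1 u, ?Z1 u)) + entropy q (\<lambda>u. (?B2 u, ?Z1 u)) - 2 * entropy q ?Z1)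
    + \<eta> * (CC q ?A1 ?Z1 + CC q ?B2 ?Z1)"
    by (rule \<Phi>_le_cond[OF pq]) (unfold q_def, rule cond_indep_coupling, rule nn)
  have HZ: "entropy q ?Z1 = HC"
    using law1[of Z] by (simp add: HC_def Z_def)
  have HAZ: "entropy q (\<lambda>u. (?A1 u, ?Z1 u)) = HAB"
    using law1[of "\<lambda>w. (A w, Z w)"] unfolding HAB_def Z_def
    by simp (rule entropy_cong_support, auto)
  have HBZ: "entropy q (\<lambda>u. (?B2 u, ?Z1 u)) = HAB"
    unfolding Z2[of B] unfolding HAB_def Z_def by (rule entropy_cong_support) auto
  have CA: "CC q ?A1 ?Z1 = CC p A Z" using law1[of "\<lambda>w. (A w, Z w)"] by (simp add: CC_def)
  have CB: "CC q ?B2 ?Z1 = CC p B Z" by (simp add: CC_def Z2)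
  have le1: "entropy q (\<lambda>u. (?D u, ?A1 u + ?B1 u, ?S1 u)) + entropy q ?S1 \<le>
      entropy q (\<lambda>u. (?D u, ?S1 u)) + entropy q (\<lambda>u. (?A1 u + ?B1 u, ?S1 u))"
    by (rule entropy_submodular) (rule q0)
  \<comment> \<open>This bounds H(D, S) from above: by \<open>eq5\<close> and \<open>ci\<close> the
    first term is 2 HAB - HC, while by \<open>eq3\<close> and \<open>eq4\<close> the terms on the
    right are entropies of (A1, B2, S) and (B1, A2, S), which \<open>le3\<close> and
    \<open>le4\<close> control.\<close>
  have le2: "entropy q (\<lambda>u. (?A1 u, ?B1 u, (?D u, ?S1 u))) + entropy q (\<lambda>u. (?D u, ?S1 u)) \<le>
      entropy q (\<lambda>u. (?A1 u, (?D u, ?S1 u))) + entropy q (\<lambda>u. (?B1 u, (?D u, ?S1 u)))"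
    by (rule entropy_submodular) (rule q0)
  have le3: "entropy q (\<lambda>u. (?A1 u, ?B2 u, ?S1 u)) + entropy q ?S1 \<le>
      entropy q (\<lambda>u. (?A1 u, ?S1 u)) + entropy q (\<lambda>u. (?B2 u, ?S1 u))"
    by (rule entropy_submodular) (rule q0)
  have le4: "entropy q (\<lambda>u. (?B1 u, ?A2 u, ?S1 u)) + entropy q ?S1 \<le>
      entropy q (\<lambda>u. (?B1 u, ?S1 u)) + entropy q (\<lambda>u. (?A2 u, ?S1 u))"
    by (rule entropy_submodular) (rule q0)
  have eq3: "entropy q (\<lambda>u. (?A1 u, ?B2 u, ?S1 u)) = entropy q (\<lambda>u. (?A1 u, (?D u, ?S1 u)))"
    by (rule entropy_cong_support) auto
  have D: "?D u = ?B1 u + ?A2 u" if "q u \<noteq> 0" for u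
    using supp[OF that] by (metis add.commute add.left_commute add_self_left)
  have eq4: "entropy q (\<lambda>u. (?B1 u, ?A2 u, ?S1 u)) = entropy q (\<lambda>u. (?B1 u, (?D u, ?S1 u)))"
    by (rule entropy_cong_support) (use D in auto)
  have ci: "entropy q (\<lambda>u. ((?A1 u, ?B1 u), (?A2 u, ?B2 u), ?Z1 u)) + entropy q ?Z1 =
      entropy q (\<lambda>u. ((?A1 u, ?B1 u), ?Z1 u)) + entropy q (\<lambda>u. ((?A2 u, ?B2 u), ?Z1 u))"
    by (rule entropy_cond_indep[OF q0])
      (use cond_indep_coupling[of p Z "\<lambda>w. (A w, B w)" "\<lambda>w. (A w, B w)", OF nn] in \<open>simp add: q_def\<close>)
  \<comment> \<open>B2 is D + A1, and then A1 + B1 = A2 + B2 yields A2: the quadruple determines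
    both copies.\<close>
  have eq5: "entropy q (\<lambda>u. ((?A1 u, ?B1 u), (?A2 u, ?B2 u), ?Z1 u)) =
      entropy q (\<lambda>u. (?A1 u, ?B1 u, (?D u, ?S1 u)))"
  proof (rule entropy_cong_support)
    fix u u' assume u: "q u \<noteq> 0" and u': "q u' \<noteq> 0"
    show "((?A1 u, ?B1 u), (?A2 u, ?B2 u), ?Z1 u) = ((?A1 u', ?B1 u'), (?A2 u', ?B2 u'), ?Z1 u') \<longleftrightarrow>
      (?A1 u, ?B1 u, (?D u, ?S1 u)) = (?A1 u', ?B1 u', (?D u', ?S1 u'))"
      using supp[OF u] supp[OF u'] by (auto simp: Z_def) (metis add_right_imp_eq)
  qed
  have e6: "entropy q (\<lambda>u. ((?A1 u, ?B1 u), ?Z1 u)) = HAB"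
    using law1[of "\<lambda>w. ((A w, B w), Z w)"] unfolding HAB_def Z_def
    by simp (rule entropy_cong_support, auto)
  have e7: "entropy q (\<lambda>u. ((?A2 u, ?B2 u), ?Z1 u)) = HAB"
    using Z2[of "\<lambda>w. (A w, B w)"] unfolding HAB_def Z_def
    by simp (rule entropy_cong_support, auto)
  have e8: "entropy q (\<lambda>u. (?A1 u, ?S1 u)) = HA" "entropy q (\<lambda>u. (?B1 u, ?S1 u)) = HB"
    "entropy q (\<lambda>u. (?A2 u, ?S1 u)) = HA" "entropy q (\<lambda>u. (?B2 u, ?S1 u)) = HB"
    "entropy q ?S1 = HS" "entropy q (\<lambda>u. (?A1 u + ?B1 u, ?S1 u)) = HC"
    using law1[of "\<lambda>w. (A w, S w)"] law1[of "\<lambda>w. (B w, S w)"] S2[of A] S2[of B]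
      law1[of S] law1[of "\<lambda>w. (A w + B w, S w)"]
    by (simp_all add: HA_def HB_def HS_def HC_def)
  have e9: "entropy q (\<lambda>u. (?D u, ?A1 u + ?B1 u, ?S1 u)) = entropy q (\<lambda>u. (?D u, ?Z1 u))"
    by (simp add: Z_def)
  have "entropy q (\<lambda>u. (?D u, ?Z1 u)) - entropy q ?Z1 \<le> 2 * HA + 2 * HB - 3 * HS - 2 * HAB + HC"
    using le1 le2 le3 le4 ci unfolding e8 HZ e6 e7 eq3 eq4 eq5 e9 by linarith
  moreover have "(1 + \<eta>) / 2 * (HAB + HAB - 2 * HC) = (1 + \<eta>) * (HAB - HC)"
    by (simp add: field_simps)
  ultimately have "\<Phi> \<le> 2 * HA + 2 * HB - 3 * HS - 2 * HAB + HC - (1 + \<eta>) * (HAB - HC)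
      + \<eta> * (CC p A Z + CC p B Z)"
    using main unfolding HAZ HBZ HZ CA CB by linarith
  then show ?thesis unfolding Z_def .
qed

end

section \<open>Sums of four independent variables\<close>

definition indep :: "('w::finite \<Rightarrow> real) \<Rightarrow> ('w \<Rightarrow> 'a) \<Rightarrow> ('w \<Rightarrow> 'b) \<Rightarrow> bool"
  where "indep p U V \<longleftrightarrow> (\<forall>u v. law p (\<lambda>w. (U w, V w)) (u, v) = law p U u * law p V v)"

lemma indep_fun:
  fixes U :: "'w::finite \<Rightarrow> 'a::finite" and V :: "'w \<Rightarrow> 'b::finite"
  assumes "indep p U V"
  shows "indep p (\<lambda>w. f (U w)) (\<lambda>w. g (V w))"
  unfolding indep_def
proof (intro allI)
  fix x y
  have "law p (\<lambda>w. (f (U w), g (V w))) (x, y) =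
      (\<Sum>(u, v) | f u = x \<and> g v = y. law p (\<lambda>w. (U w, V w)) (u, v))"
    using law_comp[of p "\<lambda>(u, v). (f u, g v)" "\<lambda>w. (U w, V w)" "(x, y)"]
    by (simp add: case_prod_unfold)
  also have "{(u, v). f u = x \<and> g v = y} = {u. f u = x} \<times> {v. g v = y}" by auto
  also have "(\<Sum>(u, v)\<in>\<dots>. law p (\<lambda>w. (U w, V w)) (u, v)) =
      law p (\<lambda>w. f (U w)) x * law p (\<lambda>w. g (V w)) y"
    using assms by (simp add: indep_def law_comp sum_product flip: sum.cartesian_product)
  finally show "law p (\<lambda>w. (f (U w), g (V w))) (x, y) = law p (\<lambda>w. f (U w)) x * law p (\<lambda>w. g (V w)) y" .
qed

text \<open>Independent variables stay independent when each is conditioned on a function of itself.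
  This is what allows the pair of fibres Y1 given Y1 + Y3 and Y2 given Y2 + Y4 to compete with the
  minimiser.\<close>

lemma indep_cond_indep:
  fixes U :: "'w::finite \<Rightarrow> 'a::finite" and V :: "'w \<Rightarrow> 'b::finite"
    and h :: "'a \<Rightarrow> 'e" and k :: "'b \<Rightarrow> 'f"
  assumes "indep p U V"
  shows "cond_indep p (\<lambda>w. f (U w)) (\<lambda>w. g (V w)) (\<lambda>w. (h (U w), k (V w)))"
  unfolding cond_indep_def
proof (intro allI)
  fix x y and z :: "'e \<times> 'f"
  obtain z1 z2 where z: "z = (z1, z2)" by force
  have 1: "law p (\<lambda>w. (f (U w), g (V w), h (U w), k (V w))) (x, y, z1, z2) =
      law p (\<lambda>w. ((f (U w), h (U w)), (g (V w), k (V w)))) ((x, z1), (y, z2))"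
    by (rule law_cong_support) auto
  have 2: "law p (\<lambda>w. (f (U w), h (U w), k (V w))) (x, z1, z2) =
      law p (\<lambda>w. ((f (U w), h (U w)), k (V w))) ((x, z1), z2)"
    by (rule law_cong_support) auto
  have 3: "law p (\<lambda>w. (g (V w), h (U w), k (V w))) (y, z1, z2) =
      law p (\<lambda>w. (h (U w), (g (V w), k (V w)))) (z1, (y, z2))"
    by (rule law_cong_support) auto
  show "law p (\<lambda>w. (f (U w), g (V w), h (U w), k (V w))) (x, y, z) *
      law p (\<lambda>w. (h (U w), k (V w))) z =
      law p (\<lambda>w. (f (U w), h (U w), k (V w))) (x, z) *
      law p (\<lambda>w. (g (V w), h (U w), k (V w))) (y, z)"
    using indep_fun[OF assms, of "\<lambda>u. (f u, h u)" "\<lambda>v. (g v, k v)"] indep_fun[OF assms, of h k]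
      indep_fun[OF assms, of "\<lambda>u. (f u, h u)" k] indep_fun[OF assms, of h "\<lambda>v. (g v, k v)"]
    unfolding z 1 2 3 by (simp add: indep_def)
qed

lemma law_unit: "pdist p \<Longrightarrow> law p (\<lambda>_. ()) u = 1"
  by (simp add: law_def pdist_def)

lemma entropy_unit: "pdist p \<Longrightarrow> entropy p (\<lambda>_. ()) = 0"
  by (simp add: ent_def law_unit)

lemma indep_cond_indep_unit:
  assumes "pdist p" "indep p U V"
  shows "cond_indep p U V (\<lambda>_. ())"
proof -
  have "law p (\<lambda>w. (U w, V w, ())) (u, v, ()) = law p (\<lambda>w. (U w, V w)) (u, v)"
    "law p (\<lambda>w. (U w, ())) (u, ()) = law p U u" "law p (\<lambda>w. (V w, ())) (v, ()) = law p V v" for u v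
    by (rule law_cong_support; auto)+
  with assms show ?thesis
    by (simp add: cond_indep_def indep_def law_unit)
qed

lemma entropy_indep:
  fixes U :: "'w::finite \<Rightarrow> 'a::finite" and V :: "'w \<Rightarrow> 'b::finite"
  assumes p: "pdist p" and "indep p U V"
  shows "entropy p (\<lambda>w. (U w, V w)) = entropy p U + entropy p V"
proof -
  have "entropy p (\<lambda>w. (U w, V w, ())) = entropy p (\<lambda>w. (U w, V w))"
    "entropy p (\<lambda>w. (U w, ())) = entropy p U" "entropy p (\<lambda>w. (V w, ())) = entropy p V"
    by (rule entropy_cong_support; auto)+
  with entropy_cond_indep[OF pdist_nonneg[OF p] indep_cond_indep_unit[OF assms]] entropy_unit[OF p]
  show ?thesis by simp
qed

lemma law_add_indep:
  fixes U V :: "'w::finite \<Rightarrow> 'a::boolean_group"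
  assumes "indep p U V"
  shows "law p (\<lambda>w. U w + V w) = conv (law p U) (law p V)"
proof
  fix x
  have "law p (\<lambda>w. U w + V w) x = (\<Sum>v | fst v + snd v = x. law p (\<lambda>w. (U w, V w)) v)"
    using law_comp[of p "\<lambda>v. fst v + snd v" "\<lambda>w. (U w, V w)"] by simp
  also have "\<dots> = (\<Sum>y\<in>UNIV. law p (\<lambda>w. (U w, V w)) (y, x + y))"
    by (rule sum.reindex_bij_witness[where i = "\<lambda>y. (y, x + y)" and j = fst]) (auto simp: ac_simps)
  finally show "law p (\<lambda>w. U w + V w) x = conv (law p U) (law p V) x"
    using assms by (simp add: conv_def indep_def)
qed

definition indep4 where
  "indep4 p Y1 Y2 Y3 Y4 \<longleftrightarrow> (\<forall>a b c d. law p (\<lambda>w. (Y1 w, Y2 w, Y3 w, Y4 w)) (a, b, c, d) =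
    law p Y1 a * law p Y2 b * law p Y3 c * law p Y4 d)"

lemma indep4_swap12:
  assumes "indep4 p Y1 Y2 Y3 Y4"
  shows "indep4 p Y2 Y1 Y3 Y4"
proof -
  have "law p (\<lambda>w. (Y2 w, Y1 w, Y3 w, Y4 w)) (b, a, c, d) = law p (\<lambda>w. (Y1 w, Y2 w, Y3 w, Y4 w)) (a, b, c, d)" for a b c d
    by (rule law_cong_support) auto
  with assms show ?thesis by (simp add: indep4_def mult_ac)
qed

lemma indep4_swap23:
  assumes "indep4 p Y1 Y2 Y3 Y4"
  shows "indep4 p Y1 Y3 Y2 Y4"
proof -
  have "law p (\<lambda>w. (Y1 w, Y3 w, Y2 w, Y4 w)) (a, c, b, d) = law p (\<lambda>w. (Y1 w, Y2 w, Y3 w, Y4 w)) (a, b, c, d)" for a b c d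
    by (rule law_cong_support) auto
  with assms show ?thesis by (simp add: indep4_def mult_ac)
qed

lemma indep4_swap_pairs:
  assumes "indep4 p Y1 Y2 Y3 Y4"
  shows "indep4 p Y3 Y4 Y1 Y2"
proof -
  have "law p (\<lambda>w. (Y3 w, Y4 w, Y1 w, Y2 w)) (c, d, a, b) = law p (\<lambda>w. (Y1 w, Y2 w, Y3 w, Y4 w)) (a, b, c, d)" for a b c d
    by (rule law_cong_support) auto
  with assms show ?thesis by (simp add: indep4_def mult_ac)
qed

lemma indep4_pairs:
  fixes Y1 :: "'w::finite \<Rightarrow> 'a::finite" and Y2 :: "'w \<Rightarrow> 'b::finite"
    and Y3 :: "'w \<Rightarrow> 'c::finite" and Y4 :: "'w \<Rightarrow> 'd::finite"
  assumes p: "pdist p" and i: "indep4 p Y1 Y2 Y3 Y4"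
  shows "indep p (\<lambda>w. (Y1 w, Y2 w)) (\<lambda>w. (Y3 w, Y4 w))" "indep p Y1 Y2" "indep p Y3 Y4"
proof -
  have sum1: "sum (law p Y) UNIV = 1" for Y :: "'w \<Rightarrow> 'e::finite"
    using pdist_law[OF p, of Y] by (simp add: pdist_def)
  have a: "law p (\<lambda>w. ((Y1 w, Y2 w), (Y3 w, Y4 w))) ((a, b), (c, d)) =
    law p Y1 a * law p Y2 b * law p Y3 c * law p Y4 d" for a b c d
  proof -
    have "law p (\<lambda>w. ((Y1 w, Y2 w), (Y3 w, Y4 w))) ((a, b), (c, d)) =
        law p (\<lambda>w. (Y1 w, Y2 w, Y3 w, Y4 w)) (a, b, c, d)"
      by (rule law_cong_support) auto
    with i show ?thesis by (simp add: indep4_def)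
  qed
  have 12: "law p (\<lambda>w. (Y1 w, Y2 w)) (a, b) = law p Y1 a * law p Y2 b" for a b
  proof -
    have "law p (\<lambda>w. (Y1 w, Y2 w)) (a, b) =
        (\<Sum>c\<in>UNIV. \<Sum>d\<in>UNIV. law p Y1 a * law p Y2 b * law p Y3 c * law p Y4 d)"
      unfolding sum_law_Pair2[of p "\<lambda>w. (Y1 w, Y2 w)" "\<lambda>w. (Y3 w, Y4 w)", symmetric]
      by (simp add: sum_UNIV_prod a)
    then show ?thesis by (simp add: sum1 flip: sum_distrib_left)
  qed
  have 34: "law p (\<lambda>w. (Y3 w, Y4 w)) (c, d) = law p Y3 c * law p Y4 d" for c d
  proof -
    have "law p (\<lambda>w. (Y3 w, Y4 w)) (c, d) =
        (\<Sum>a\<in>UNIV. \<Sum>b\<in>UNIV. law p Y1 a * law p Y2 b * law p Y3 c * law p Y4 d)"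
      unfolding sum_law_Pair[of p "\<lambda>w. (Y1 w, Y2 w)" "\<lambda>w. (Y3 w, Y4 w)", symmetric]
      by (simp add: sum_UNIV_prod a)
    then show ?thesis by (simp add: sum1 flip: sum_distrib_right sum_distrib_left)
  qed
  show "indep p Y1 Y2" "indep p Y3 Y4" by (simp_all add: indep_def 12 34)
  show "indep p (\<lambda>w. (Y1 w, Y2 w)) (\<lambda>w. (Y3 w, Y4 w))"
    by (simp add: indep_def a 12 34)
qed

context conv_functional
begin

lemma C_add_indep:
  assumes p: "pdist p" and "indep p U V"
  shows "C (law p (\<lambda>w. U w + V w)) \<le> C (law p U) + entropy p (\<lambda>w. U w + V w) - entropy p U"
    "C (law p (\<lambda>w. U w + V w)) \<le> C (law p V) + entropy p (\<lambda>w. U w + V w) - entropy p V"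
proof -
  note d = pdist_law[OF p]
  have "0 \<le> law p X x" for X :: "'b \<Rightarrow> 'a" and x using d pdist_nonneg by blast
  then show "C (law p (\<lambda>w. U w + V w)) \<le> C (law p U) + entropy p (\<lambda>w. U w + V w) - entropy p U"
    "C (law p (\<lambda>w. U w + V w)) \<le> C (law p V) + entropy p (\<lambda>w. U w + V w) - entropy p V"
    using C_conv[of "law p U" "law p V"] C_conv[of "law p V" "law p U"] d[of U] d[of V]
    by (simp_all add: law_add_indep[OF assms(2)] conv_commute[of "law p V"])
qed

context
  fixes p :: "'w::finite \<Rightarrow> real"
  assumes p: "pdist p"
begin

abbreviation H :: "('w \<Rightarrow> 'c::finite) \<Rightarrow> real" where "H \<equiv> entropy p"

text \<open>These three sums generate all pairwise sums, so the value is symmetric in the four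
  variables.\<close>

definition sums_ent :: "('w \<Rightarrow> 'a) \<Rightarrow> ('w \<Rightarrow> 'a) \<Rightarrow> ('w \<Rightarrow> 'a) \<Rightarrow> ('w \<Rightarrow> 'a) \<Rightarrow> real" where
  "sums_ent Y1 Y2 Y3 Y4 = H (\<lambda>w. (Y1 w + Y2 w, Y1 w + Y3 w, Y1 w + Y4 w))"

text \<open>This is C(T | T', S) with T = Y1 + Y2, T' = Y1 + Y3 and S the total. Replacing T by T +
  S or T' by T' + S changes nothing, so only the pairings 12|34 and 13|24 matter, and any of the
  four variables can take the place of Y1.\<close>

definition CC_sums :: "('w \<Rightarrow> 'a) \<Rightarrow> ('w \<Rightarrow> 'a) \<Rightarrow> ('w \<Rightarrow> 'a) \<Rightarrow> ('w \<Rightarrow> 'a) \<Rightarrow> real" where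
  "CC_sums Y1 Y2 Y3 Y4 = CC p (\<lambda>w. Y1 w + Y2 w) (\<lambda>w. (Y1 w + Y3 w, Y1 w + Y2 w + Y3 w + Y4 w))"

lemma sums_ent_swap12: "sums_ent Y1 Y2 Y3 Y4 = sums_ent Y2 Y1 Y3 Y4"
  unfolding sums_ent_def
  by (rule entropy_recode[where f = "\<lambda>(x, y, z). (x, x + y, x + z)" and g = "\<lambda>(x, y, z). (x, x + y, x + z)"])
    (auto simp: ac_simps)

lemma sums_ent_swap23: "sums_ent Y1 Y2 Y3 Y4 = sums_ent Y1 Y3 Y2 Y4"
  unfolding sums_ent_def
  by (rule entropy_recode[where f = "\<lambda>(x, y, z). (y, x, z)" and g = "\<lambda>(x, y, z). (y, x, z)"])
    (auto simp: ac_simps)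

lemma sums_ent_swap_pairs: "sums_ent Y1 Y2 Y3 Y4 = sums_ent Y3 Y4 Y1 Y2"
  unfolding sums_ent_def
  by (rule entropy_recode[where f = "\<lambda>(x, y, z). (y + z, y, y + x)" and g = "\<lambda>(x, y, z). (y + z, y, x + y)"])
    (auto simp: ac_simps)

lemma CC_cong_cond:
  fixes X :: "'w \<Rightarrow> 'a" and Z :: "'w \<Rightarrow> 'c::finite" and Z' :: "'w \<Rightarrow> 'd::finite"
  assumes "\<And>w. Z' w = f (Z w)" "\<And>w. Z w = g (Z' w)"
  shows "CC p X Z = CC p X Z'"
  by (intro antisym CC_mono[where f = f] CC_mono[where f = g] pdist_nonneg[OF p] assms)

lemma CC_sums_swap_pairs: "CC_sums Y1 Y2 Y3 Y4 = CC_sums Y3 Y4 Y1 Y2"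
proof -
  have "CC_sums Y1 Y2 Y3 Y4 = CC p (\<lambda>w. (Y1 w + Y2 w) + snd (Y1 w + Y3 w, Y1 w + Y2 w + Y3 w + Y4 w))
      (\<lambda>w. (Y1 w + Y3 w, Y1 w + Y2 w + Y3 w + Y4 w))"
    unfolding CC_sums_def by (rule CC_add_fun[OF pdist_nonneg[OF p], symmetric])
  then show ?thesis
    by (simp add: CC_sums_def ac_simps)
qed

lemma CC_sums_swap_within: "CC_sums Y1 Y2 Y3 Y4 = CC_sums Y2 Y1 Y4 Y3"
  unfolding CC_sums_def add.commute[of "Y1 _" "Y2 _"]
  by (rule CC_cong_cond[where f = "\<lambda>(x, s). (s + x, s)" and g = "\<lambda>(x, s). (s + x, s)"])
    (auto simp: ac_simps)

text \<open>The condition is equivalent to (Y1 + Y3, Y2 + Y4), given which Y1 and Y2 are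
  independent. Data processing removes Y2 on each slice, and only afterwards is the condition
  dropped.\<close>

lemma CC_sums_le_fibre:
  assumes i: "indep4 p Y1 Y2 Y3 Y4"
  shows "CC_sums Y1 Y2 Y3 Y4 \<le> C (law p Y1) + sums_ent Y1 Y2 Y3 Y4 - H (\<lambda>w. Y2 w + Y4 w) - H Y1 - H Y3"
proof -
  note nn = pdist_nonneg[OF p]
  note i' = indep4_pairs[OF p indep4_swap23[OF i]]
  let ?Z = "\<lambda>w. (Y1 w + Y3 w, Y2 w + Y4 w)"
  have ci: "cond_indep p Y1 Y2 ?Z"
    using indep_cond_indep[OF i'(1), of fst fst "\<lambda>(x, y). x + y" "\<lambda>(x, y). x + y"] by simp
  have "CC_sums Y1 Y2 Y3 Y4 = CC p (\<lambda>w. Y1 w + Y2 w) ?Z"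
    unfolding CC_sums_def
    by (rule CC_cong_cond[where f = "\<lambda>(x, s). (x, s + x)" and g = "\<lambda>(x, s). (x, s + x)"])
      (auto simp: ac_simps)
  also have "\<dots> \<le> CC p Y1 ?Z + H (\<lambda>w. (Y1 w + Y2 w, ?Z w)) - H (\<lambda>w. (Y1 w, ?Z w))"
    using CC_add_cond_indep[of p Y1 Y2 ?Z, OF nn ci] by simp
  also have "H (\<lambda>w. (Y1 w + Y2 w, ?Z w)) = sums_ent Y1 Y2 Y3 Y4"
    unfolding sums_ent_def
    by (rule entropy_recode[where f = "\<lambda>(x, y, z). (x, y, x + z)" and g = "\<lambda>(x, y, z). (x, y, x + z)"])
      (auto simp: ac_simps)
  also have "H (\<lambda>w. (Y1 w, ?Z w)) = H (\<lambda>w. ((Y1 w, Y3 w), Y2 w + Y4 w))"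
    by (rule entropy_cong_support) auto
  also have "\<dots> = H Y1 + H Y3 + H (\<lambda>w. Y2 w + Y4 w)"
    using entropy_indep[OF p indep_fun[OF i'(1), of "\<lambda>x. x" "\<lambda>(x, y). x + y"]] entropy_indep[OF p i'(2)]
    by simp
  also have "CC p Y1 ?Z \<le> C (law p Y1)" by (rule CC_le_C[OF nn])
  finally show ?thesis by simp
qed

text \<open>The opposite order to \<open>CC_sums_le_fibre\<close>: first the condition is dropped,
  then Y2 is removed by data processing.\<close>

lemma CC_sums_le_sum:
  assumes i: "indep4 p Y1 Y2 Y3 Y4"
  shows "CC_sums Y1 Y2 Y3 Y4 \<le> C (law p Y1) + H (\<lambda>w. Y1 w + Y2 w) - H Y1"
proof -
  have "CC_sums Y1 Y2 Y3 Y4 \<le> C (law p (\<lambda>w. Y1 w + Y2 w))"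
    unfolding CC_sums_def by (rule CC_le_C[OF pdist_nonneg[OF p]])
  also note C_add_indep(1)[OF p indep4_pairs(2)[OF p i]]
  finally show ?thesis .
qed

text \<open>The sum of eight bounds, two for each variable in the place of Y1. The entropies of pair
  sums that remain are antisymmetric under exchange of the two pairings, so they cancel once both
  orders are added.\<close>

lemma CC_sums_le:
  assumes i: "indep4 p Y1 Y2 Y3 Y4"
  shows "8 * CC_sums Y1 Y2 Y3 Y4 \<le> 2 * (C (law p Y1) + C (law p Y2) + C (law p Y3) + C (law p Y4))
    - 3 * (H Y1 + H Y2 + H Y3 + H Y4) + 4 * sums_ent Y1 Y2 Y3 Y4
    + 2 * (H (\<lambda>w. Y1 w + Y2 w) + H (\<lambda>w. Y3 w + Y4 w) - H (\<lambda>w. Y1 w + Y3 w) - H (\<lambda>w. Y2 w + Y4 w))"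
proof -
  have i3: "indep4 p Y3 Y4 Y1 Y2" by (rule indep4_swap_pairs[OF i])
  have i2: "indep4 p Y2 Y1 Y4 Y3"
    by (rule indep4_swap12[OF indep4_swap_pairs[OF indep4_swap12[OF i3]]])
  have i4: "indep4 p Y4 Y3 Y2 Y1" by (rule indep4_swap_pairs[OF i2])
  have T3: "sums_ent Y3 Y4 Y1 Y2 = sums_ent Y1 Y2 Y3 Y4" by (rule sums_ent_swap_pairs)
  have T2: "sums_ent Y2 Y1 Y4 Y3 = sums_ent Y1 Y2 Y3 Y4"
    using sums_ent_swap12[of Y2 Y1 Y4 Y3] sums_ent_swap_pairs[of Y1 Y2 Y4 Y3] sums_ent_swap12[of Y4 Y3 Y1 Y2] T3 by simp
  have T4: "sums_ent Y4 Y3 Y2 Y1 = sums_ent Y1 Y2 Y3 Y4" using sums_ent_swap_pairs[of Y4 Y3 Y2 Y1] T2 by simp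
  have CC_sums: "CC_sums Y2 Y1 Y4 Y3 = CC_sums Y1 Y2 Y3 Y4" "CC_sums Y3 Y4 Y1 Y2 = CC_sums Y1 Y2 Y3 Y4" "CC_sums Y4 Y3 Y2 Y1 = CC_sums Y1 Y2 Y3 Y4"
    using CC_sums_swap_pairs[of Y1 Y2 Y3 Y4] CC_sums_swap_within[of Y1 Y2 Y3 Y4] CC_sums_swap_within[of Y3 Y4 Y1 Y2] by simp_all
  have c: "H (\<lambda>w. Y2 w + Y1 w) = H (\<lambda>w. Y1 w + Y2 w)" "H (\<lambda>w. Y4 w + Y3 w) = H (\<lambda>w. Y3 w + Y4 w)"
    "H (\<lambda>w. Y3 w + Y1 w) = H (\<lambda>w. Y1 w + Y3 w)" "H (\<lambda>w. Y4 w + Y2 w) = H (\<lambda>w. Y2 w + Y4 w)"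
    by (simp_all add: add.commute)
  show ?thesis
    using CC_sums_le_fibre[OF i] CC_sums_le_fibre[OF i2] CC_sums_le_fibre[OF i3] CC_sums_le_fibre[OF i4]
      CC_sums_le_sum[OF i] CC_sums_le_sum[OF i2] CC_sums_le_sum[OF i3] CC_sums_le_sum[OF i4]
    unfolding T2 T3 T4 CC_sums c by argo
qed

end

end

section \<open>A minimiser has doubling constant one\<close>

definition prod_dist :: "('a::finite \<Rightarrow> real) \<Rightarrow> ('b::finite \<Rightarrow> real) \<Rightarrow> 'a \<times> 'b \<Rightarrow> real"
  where "prod_dist p q = (\<lambda>(x, y). p x * q y)"

lemma pdist_prod_dist: "pdist p \<Longrightarrow> pdist q \<Longrightarrow> pdist (prod_dist p q)"
  by (auto simp: pdist_def prod_dist_def sum_UNIV_prod simp flip: sum_distrib_left)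

lemma law_prod_dist_fst:
  assumes "pdist q"
  shows "law (prod_dist p q) (\<lambda>u. f (fst u)) = law p (f :: 'a::finite \<Rightarrow> 'c::finite)"
proof -
  have "law (prod_dist p q) fst x = p x" for x
  proof -
    have "law (prod_dist p q) fst x = (\<Sum>y\<in>UNIV. prod_dist p q (x, y))"
      unfolding law_def by (rule sum.reindex_bij_witness[where i = "\<lambda>y. (x, y)" and j = snd]) auto
    with assms show ?thesis by (simp add: prod_dist_def pdist_def flip: sum_distrib_left)
  qed
  then show ?thesis
    using law_comp[of "prod_dist p q" f fst] by (auto simp: law_def[of p f])
qed

lemma law_prod_dist_snd:
  assumes "pdist p"
  shows "law (prod_dist p q) (\<lambda>u. f (snd u)) = law q (f :: 'a::finite \<Rightarrow> 'c::finite)"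
proof -
  have "law (prod_dist p q) snd y = q y" for y
  proof -
    have "law (prod_dist p q) snd y = (\<Sum>x\<in>UNIV. prod_dist p q (x, y))"
      unfolding law_def by (rule sum.reindex_bij_witness[where i = "\<lambda>x. (x, y)" and j = fst]) auto
    with assms show ?thesis by (simp add: prod_dist_def pdist_def flip: sum_distrib_right)
  qed
  then show ?thesis
    using law_comp[of "prod_dist p q" f snd] by (auto simp: law_def[of q f])
qed

lemma law_id: "law p (\<lambda>x. x) = p"
  by (simp add: law_def fun_eq_iff)

lemma exists_indep4:
  fixes q1 q2 q3 q4 :: "'a::finite \<Rightarrow> real"
  assumes "pdist q1" "pdist q2" "pdist q3" "pdist q4"
  obtains p :: "'a \<times> 'a \<times> 'a \<times> 'a \<Rightarrow> real" and Y1 Y2 Y3 Y4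
  where "pdist p" "indep4 p Y1 Y2 Y3 Y4" "law p Y1 = q1" "law p Y2 = q2" "law p Y3 = q3" "law p Y4 = q4"
proof
  let ?p = "prod_dist q1 (prod_dist q2 (prod_dist q3 q4))"
  let ?Y1 = "\<lambda>u::'a \<times> 'a \<times> 'a \<times> 'a. fst u" and ?Y2 = "\<lambda>u::'a \<times> 'a \<times> 'a \<times> 'a. fst (snd u)"
  let ?Y3 = "\<lambda>u::'a \<times> 'a \<times> 'a \<times> 'a. fst (snd (snd u))" and ?Y4 = "\<lambda>u::'a \<times> 'a \<times> 'a \<times> 'a. snd (snd (snd u))"
  note d = assms pdist_prod_dist
  show "pdist ?p" by (intro d)
  show l1: "law ?p ?Y1 = q1"
    using law_prod_dist_fst[of "prod_dist q2 (prod_dist q3 q4)" q1 "\<lambda>x. x"] by (simp add: d law_id)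
  show l2: "law ?p ?Y2 = q2"
    using law_prod_dist_snd[of q1 "prod_dist q2 (prod_dist q3 q4)" fst]
      law_prod_dist_fst[of "prod_dist q3 q4" q2 "\<lambda>x. x"] by (simp add: d law_id)
  show l3: "law ?p ?Y3 = q3"
    using law_prod_dist_snd[of q1 "prod_dist q2 (prod_dist q3 q4)" "\<lambda>u. fst (snd u)"]
      law_prod_dist_snd[of q2 "prod_dist q3 q4" fst]
      law_prod_dist_fst[of q4 q3 "\<lambda>x. x"] by (simp add: d law_id)
  show l4: "law ?p ?Y4 = q4"
    using law_prod_dist_snd[of q1 "prod_dist q2 (prod_dist q3 q4)" "\<lambda>u. snd (snd u)"]
      law_prod_dist_snd[of q2 "prod_dist q3 q4" snd]
      law_prod_dist_snd[of q3 q4 "\<lambda>x. x"] by (simp add: d law_id)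
  have "law ?p (\<lambda>w. (?Y1 w, ?Y2 w, ?Y3 w, ?Y4 w)) = ?p"
    using law_id[of ?p] by simp
  then show "indep4 ?p ?Y1 ?Y2 ?Y3 ?Y4"
    unfolding indep4_def l1 l2 l3 l4 by (simp add: prod_dist_def)
qed

text \<open>
  Here \<open>k\<^sub>i\<^sub>j\<close> is the entropy of the sum of independent copies of \<open>X\<^sub>i\<close> and \<open>X\<^sub>j\<close>, \<open>s\<close> that of the sum of
  all four variables \<open>X\<^sub>1, X\<^sub>2, X\<^sub>1', X\<^sub>2'\<close>, \<open>t\<close> the joint entropy of their pairwise sums, and \<open>R\<close> the
  total of the six terms \<open>C(T\<^sub>i | T\<^sub>j, S)\<close>. The quantities \<open>I1\<close> and \<open>I2\<close> of the proof are the
  conditional mutual informations of the pairwise sums given \<open>S\<close>.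
\<close>

lemma endgame_arith:
  fixes \<eta> \<Phi> k11 k12 k22 h1 h2 s t c1 c2 :: real
  assumes \<eta>: "0 \<le> \<eta>" "\<eta> < 1 / 8"
    and \<Phi>: "\<Phi> = k12 - (1 + \<eta>) / 2 * (h1 + h2) + \<eta> * (c1 + c2)"
    and e1: "\<Phi> \<le> s - (1 + \<eta>) / 2 * (k12 + k12) + \<eta> * (c1 + k12 - h1 + (c2 + k12 - h2))"
    and e2: "\<Phi> \<le> t - k12 - k12 - (1 + \<eta>) / 2 * (h1 + h2 - k12 + (h2 + h1 - k12)) + \<eta> * (c1 + c2)"
    and e3: "\<Phi> \<le> s - (1 + \<eta>) / 2 * (k11 + k22) + \<eta> * (c1 + k11 - h1 + (c2 + k22 - h2))"
    and e4: "\<Phi> \<le> t - k11 - k22 - (1 + \<eta>) / 2 * (h1 + h1 - k11 + (h2 + h2 - k22)) + \<eta> * (c1 + c2)"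
    and e5: "3 * \<Phi> \<le> (6 + \<eta>) * (4 * k12 + k11 + k22) - 9 * s - (9 + 3 * \<eta>) * t + \<eta> * R"
    and R: "R \<le> 3 * (c1 + c2) - 9 / 2 * (h1 + h2) + 3 * t"
  shows "k12 \<le> (h1 + h2) / 2"
proof -
  define d where "d = k12 - (h1 + h2) / 2"
  define I1 where "I1 = 4 * k12 - t - s"
  define I2 where "I2 = 2 * k12 + k11 + k22 - t - s"
  \<comment> \<open>In the sum of \<open>e1\<close> and \<open>e2\<close> the terms in
    \<open>c1\<close>, \<open>c2\<close> cancel, and \<open>s\<close>, \<open>t\<close> combine to
    the mutual information.\<close>
  have 1: "I1 \<le> 2 * \<eta> * d"
    using e1 e2 \<Phi> unfolding d_def I1_def by (simp add: field_simps)
  \<comment> \<open>The error is now \<eta> times \<open>k11 + k22 - h1 - h2\<close>, which equals 2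
    d + I2 - I1; hence I2 occurs on both sides.\<close>
  have 2: "(1 - \<eta>) * I2 \<le> \<eta> * (2 * d - I1)"
    using e3 e4 \<Phi> unfolding d_def I1_def I2_def by (simp add: field_simps)
  have "\<eta> * R \<le> \<eta> * (3 * (c1 + c2) - 9 / 2 * (h1 + h2) + 3 * t)"
    using R \<eta> by (intro mult_left_mono) auto
  then have 3: "3 * d \<le> 3 * (I1 + 2 * I2) + \<eta> * (6 * d + I2 - I1)"
    using e5 \<Phi> unfolding d_def I1_def I2_def by (simp add: field_simps)
  have "(1 - \<eta>) * (3 * d) \<le> (1 - \<eta>) * (3 * (I1 + 2 * I2) + \<eta> * (6 * d + I2 - I1))"
    using 3 \<eta> by (intro mult_left_mono) auto
  also have "\<dots> = (1 - \<eta>) * (3 * I1 + \<eta> * (6 * d - I1)) + (6 + \<eta>) * ((1 - \<eta>) * I2)"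
    by (simp add: algebra_simps)
  also have "\<dots> \<le> (1 - \<eta>) * (3 * I1 + \<eta> * (6 * d - I1)) + (6 + \<eta>) * (\<eta> * (2 * d - I1))"
    using 2 \<eta> by (intro add_left_mono mult_left_mono) auto
  also have "\<dots> = (3 - 10 * \<eta>) * I1 + (18 * \<eta> - 4 * \<eta> * \<eta>) * d"
    by (simp add: algebra_simps)
  also have "\<dots> \<le> (3 - 10 * \<eta>) * (2 * \<eta> * d) + (18 * \<eta> - 4 * \<eta> * \<eta>) * d"
    using 1 \<eta> by (intro add_right_mono mult_left_mono) auto
  \<comment> \<open>The coefficient is 3 - 27 \<eta> + 24 \<eta>^2; its smaller root is the
    threshold 1/8.\<close>
  finally have "3 * ((1 - \<eta>) * (1 - 8 * \<eta>)) * d \<le> 0"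
    by (simp add: algebra_simps)
  moreover have "0 < 3 * ((1 - \<eta>) * (1 - 8 * \<eta>))" using \<eta> by simp
  ultimately have "d \<le> 0" by (meson mult_pos_pos not_le)
  then show ?thesis by (simp add: d_def)
qed

context minimal_value
begin

lemma \<Phi>_le_sums:
  fixes Y1 Y2 Y3 Y4 :: "'w::finite \<Rightarrow> 'a"
  assumes p: "pdist p" and i: "indep4 p Y1 Y2 Y3 Y4" and \<eta>: "0 \<le> \<eta>"
  shows "\<Phi> \<le> entropy p (\<lambda>w. Y1 w + Y2 w + Y3 w + Y4 w)
    - (1 + \<eta>) / 2 * (entropy p (\<lambda>w. Y1 w + Y3 w) + entropy p (\<lambda>w. Y2 w + Y4 w))
    + \<eta> * (C (law p Y1) + entropy p (\<lambda>w. Y1 w + Y3 w) - entropy p Y1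
      + (C (law p Y2) + entropy p (\<lambda>w. Y2 w + Y4 w) - entropy p Y2))"
proof -
  note i' = indep4_pairs[OF p indep4_swap23[OF i]]
  have "indep p (\<lambda>w. Y1 w + Y3 w) (\<lambda>w. Y2 w + Y4 w)"
    using indep_fun[OF i'(1), of "\<lambda>(x, y). x + y" "\<lambda>(x, y). x + y"] by simp
  from law_add_indep[OF this]
  have "law p (\<lambda>w. Y1 w + Y2 w + Y3 w + Y4 w) = conv (law p (\<lambda>w. Y1 w + Y3 w)) (law p (\<lambda>w. Y2 w + Y4 w))"
    by (simp add: ac_simps)
  moreover have "\<eta> * (C (law p (\<lambda>w. Y1 w + Y3 w)) + C (law p (\<lambda>w. Y2 w + Y4 w))) \<le>
    \<eta> * (C (law p Y1) + entropy p (\<lambda>w. Y1 w + Y3 w) - entropy p Y1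
      + (C (law p Y2) + entropy p (\<lambda>w. Y2 w + Y4 w) - entropy p Y2))"
    by (intro mult_left_mono add_mono C_add_indep(1) p i' \<eta>)
  ultimately show ?thesis
    using \<Phi>_le[OF pdist_law[OF p, of "\<lambda>w. Y1 w + Y3 w"] pdist_law[OF p, of "\<lambda>w. Y2 w + Y4 w"]]
    by simp
qed

text \<open>The competitors are Y1 given Y1 + Y3 and Y2 given Y2 + Y4. This complements
  \<open>\<Phi>_le_sums\<close>: in \<open>endgame_arith\<close> the two bounds are added, which
  controls I(Y1 + Y2 : Y1 + Y3 | S) with S the total.\<close>

lemma \<Phi>_le_fibres:
  fixes Y1 Y2 Y3 Y4 :: "'w::finite \<Rightarrow> 'a"
  assumes p: "pdist p" and i: "indep4 p Y1 Y2 Y3 Y4" and \<eta>: "0 \<le> \<eta>"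
  shows "\<Phi> \<le> sums_ent p Y1 Y2 Y3 Y4 - entropy p (\<lambda>w. Y1 w + Y3 w) - entropy p (\<lambda>w. Y2 w + Y4 w)
    - (1 + \<eta>) / 2 * (entropy p Y1 + entropy p Y3 - entropy p (\<lambda>w. Y1 w + Y3 w)
      + (entropy p Y2 + entropy p Y4 - entropy p (\<lambda>w. Y2 w + Y4 w)))
    + \<eta> * (C (law p Y1) + C (law p Y2))"
proof -
  note nn = pdist_nonneg[OF p]
  note i' = indep4_pairs[OF p indep4_swap23[OF i]]
  let ?Z = "\<lambda>w. (Y1 w + Y3 w, Y2 w + Y4 w)"
  have ci: "cond_indep p Y1 Y2 ?Z"
    using indep_cond_indep[OF i'(1), of fst fst "\<lambda>(x, y). x + y" "\<lambda>(x, y). x + y"] by simp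
  have 1: "entropy p (\<lambda>w. (Y1 w + Y2 w, ?Z w)) = sums_ent p Y1 Y2 Y3 Y4"
    unfolding sums_ent_def[OF p]
    by (rule entropy_recode[where f = "\<lambda>(x, y, z). (x, y, x + z)" and g = "\<lambda>(x, y, z). (x, y, x + z)"])
      (auto simp: ac_simps)
  have "entropy p (\<lambda>w. (Y1 w, ?Z w)) = entropy p (\<lambda>w. ((Y1 w, Y3 w), Y2 w + Y4 w))"
    by (rule entropy_cong_support) auto
  also have "\<dots> = entropy p Y1 + entropy p Y3 + entropy p (\<lambda>w. Y2 w + Y4 w)"
    using entropy_indep[OF p indep_fun[OF i'(1), of "\<lambda>x. x" "\<lambda>(x, y). x + y"]] entropy_indep[OF p i'(2)]
    by simp
  finally have 2: "entropy p (\<lambda>w. (Y1 w, ?Z w)) = \<dots>" .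
  have "entropy p (\<lambda>w. (Y2 w, ?Z w)) = entropy p (\<lambda>w. (Y1 w + Y3 w, (Y2 w, Y4 w)))"
    by (rule entropy_cong_support) auto
  also have "\<dots> = entropy p (\<lambda>w. Y1 w + Y3 w) + (entropy p Y2 + entropy p Y4)"
    using entropy_indep[OF p indep_fun[OF i'(1), of "\<lambda>(x, y). x + y" "\<lambda>x. x"]] entropy_indep[OF p i'(3)]
    by simp
  finally have 3: "entropy p (\<lambda>w. (Y2 w, ?Z w)) = \<dots>" .
  have 4: "entropy p ?Z = entropy p (\<lambda>w. Y1 w + Y3 w) + entropy p (\<lambda>w. Y2 w + Y4 w)"
    using entropy_indep[OF p indep_fun[OF i'(1), of "\<lambda>(x, y). x + y" "\<lambda>(x, y). x + y"]] by simp
  have "\<eta> * (CC p Y1 ?Z + CC p Y2 ?Z) \<le> \<eta> * (C (law p Y1) + C (law p Y2))"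
    by (intro mult_left_mono add_mono CC_le_C nn \<eta>)
  moreover have "(1 + \<eta>) / 2 * (entropy p Y1 + entropy p Y3 + entropy p (\<lambda>w. Y2 w + Y4 w) +
      (entropy p (\<lambda>w. Y1 w + Y3 w) + (entropy p Y2 + entropy p Y4)) - 2 * entropy p ?Z) =
    (1 + \<eta>) / 2 * (entropy p Y1 + entropy p Y3 - entropy p (\<lambda>w. Y1 w + Y3 w)
      + (entropy p Y2 + entropy p Y4 - entropy p (\<lambda>w. Y2 w + Y4 w)))"
    unfolding 4 by (rule arg_cong[where f = "\<lambda>x. (1 + \<eta>) / 2 * x"]) simp
  ultimately show ?thesis
    using \<Phi>_le_cond[OF p ci] unfolding 1 2 3 using 4 by linarith
qed

text \<open>For A = Y1 + Y2 and B = Y1 + Y3 the sum A + B is again a pairwise sum, Y2 + Y3. Each of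
  the three is independent of its complement in S, so its joint entropy with S splits into two
  terms.\<close>

lemma \<Phi>_le_triple:
  fixes Y1 Y2 Y3 Y4 :: "'w::finite \<Rightarrow> 'a"
  assumes p: "pdist p" and i: "indep4 p Y1 Y2 Y3 Y4"
  defines "K \<equiv> \<lambda>X Y. entropy p (\<lambda>w. X w + Y w)"
  shows "\<Phi> \<le> 2 * (K Y1 Y2 + K Y3 Y4) + 2 * (K Y1 Y3 + K Y2 Y4)
    - 3 * entropy p (\<lambda>w. Y1 w + Y2 w + Y3 w + Y4 w) - 2 * sums_ent p Y1 Y2 Y3 Y4 + (K Y1 Y4 + K Y2 Y3)
    - (1 + \<eta>) * (sums_ent p Y1 Y2 Y3 Y4 - (K Y1 Y4 + K Y2 Y3)) + \<eta> * (CC_sums p Y2 Y1 Y3 Y4 + CC_sums p Y3 Y1 Y2 Y4)"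
proof -
  let ?S = "\<lambda>w. Y1 w + Y2 w + Y3 w + Y4 w"
  let ?A = "\<lambda>w. Y1 w + Y2 w" and ?B = "\<lambda>w. Y1 w + Y3 w"
  have pair: "entropy p (\<lambda>w. (X w, X w + Y w)) = entropy p X + entropy p Y" if "indep p X Y" for X Y :: "'w \<Rightarrow> 'a"
  proof -
    have "entropy p (\<lambda>w. (X w, X w + Y w)) = entropy p (\<lambda>w. (X w, Y w))"
      by (rule entropy_cong_support) auto
    with entropy_indep[OF p that] show ?thesis by simp
  qed
  have sums: "indep p (\<lambda>w. X1 w + X2 w) (\<lambda>w. X3 w + X4 w)" if "indep4 p X1 X2 X3 X4" for X1 X2 X3 X4 :: "'w \<Rightarrow> 'a"
    using indep_fun[OF indep4_pairs(1)[OF p that], of "\<lambda>(x, y). x + y" "\<lambda>(x, y). x + y"] by simp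
  have i2: "indep4 p Y1 Y3 Y2 Y4" by (rule indep4_swap23[OF i])
  have i3: "indep4 p Y2 Y3 Y1 Y4" by (rule indep4_swap23[OF indep4_swap12[OF i]])
  have A: "entropy p (\<lambda>w. (?A w, ?S w)) = K Y1 Y2 + K Y3 Y4"
    using pair[OF sums[OF i]] by (simp add: K_def ac_simps)
  have B: "entropy p (\<lambda>w. (?B w, ?S w)) = K Y1 Y3 + K Y2 Y4"
    using pair[OF sums[OF i2]] by (simp add: K_def ac_simps)
  have AB: "?A w + ?B w = Y2 w + Y3 w" for w by (simp add: ac_simps)
  have D: "entropy p (\<lambda>w. (?A w + ?B w, ?S w)) = K Y1 Y4 + K Y2 Y3"
    using pair[OF sums[OF i3]] unfolding AB by (simp add: K_def ac_simps)
  have E: "entropy p (\<lambda>w. (?A w, ?B w, ?S w)) = sums_ent p Y1 Y2 Y3 Y4"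
    unfolding sums_ent_def[OF p]
    by (rule entropy_recode[where f = "\<lambda>(x, y, z). (x, y, x + y + z)" and g = "\<lambda>(x, y, z). (x, y, x + y + z)"])
      (auto simp: ac_simps)
  have QA: "CC p ?A (\<lambda>w. (?A w + ?B w, ?S w)) = CC_sums p Y2 Y1 Y3 Y4"
    unfolding AB CC_sums_def[OF p] by (simp add: ac_simps)
  have QB: "CC p ?B (\<lambda>w. (?A w + ?B w, ?S w)) = CC_sums p Y3 Y1 Y2 Y4"
    unfolding AB CC_sums_def[OF p] by (simp add: ac_simps)
  show ?thesis
    using \<Phi>_le_dependent[OF p, of ?A ?S ?B] unfolding A B D E QA QB .
qed

theorem doubling_zero:
  assumes d: "pdist p1" "pdist p2" and \<eta>: "0 \<le> \<eta>" "\<eta> < 1 / 8"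
    and \<Phi>: "\<Phi> = ent (conv p1 p2) - (1 + \<eta>) / 2 * (ent p1 + ent p2) + \<eta> * (C p1 + C p2)"
  shows "ent (conv p1 p2) \<le> (ent p1 + ent p2) / 2"
proof -
  obtain p :: "'a \<times> 'a \<times> 'a \<times> 'a \<Rightarrow> real" and X1 X2 Y1 Y2 where p: "pdist p"
    and i: "indep4 p X1 X2 Y1 Y2"
    and l [simp]: "law p X1 = p1" "law p X2 = p2" "law p Y1 = p1" "law p Y2 = p2"
    using exists_indep4[OF d d] by metis
  let ?K = "\<lambda>X Y. entropy p (\<lambda>w. X w + Y w)"
  have i_swap34: "indep4 p Z1 Z2 Z4 Z3" if "indep4 p Z1 Z2 Z3 Z4" for Z1 Z2 Z3 Z4 :: "_ \<Rightarrow> 'a"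
    by (rule indep4_swap_pairs[OF indep4_swap12[OF indep4_swap_pairs[OF that]]])
  have sums_ent_swap34: "sums_ent p Z1 Z2 Z4 Z3 = sums_ent p Z1 Z2 Z3 Z4" for Z1 Z2 Z3 Z4
    using sums_ent_swap_pairs[OF p, of Z1 Z2 Z4 Z3] sums_ent_swap12[OF p, of Z4 Z3 Z1 Z2] sums_ent_swap_pairs[OF p, of Z3 Z4 Z1 Z2]
    by simp
  \<comment> \<open>The six orders that keep Y2 last, one for each ordered pair of distinct
    pairings.\<close>
  note perms = i indep4_swap23[OF i] indep4_swap12[OF i] indep4_swap12[OF indep4_swap23[OF i]]
    indep4_swap23[OF indep4_swap12[OF i]] indep4_swap12[OF indep4_swap23[OF indep4_swap12[OF i]]]
  have K: "?K X1 X2 = ent (conv p1 p2)" "?K X1 Y2 = ent (conv p1 p2)"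
    "?K X2 Y1 = ent (conv p1 p2)" "?K Y1 Y2 = ent (conv p1 p2)"
    "?K X2 X1 = ent (conv p1 p2)" "?K Y1 X2 = ent (conv p1 p2)"
    "?K X1 Y1 = ent (conv p1 p1)" "?K Y1 X1 = ent (conv p1 p1)" "?K X2 Y2 = ent (conv p2 p2)"
  proof -
    note 1 = indep4_pairs[OF p i] indep4_pairs[OF p indep4_swap23[OF i]]
      indep4_pairs[OF p indep4_swap23[OF i_swap34[OF i]]]
    show "?K X1 X2 = ent (conv p1 p2)" "?K Y1 Y2 = ent (conv p1 p2)" "?K X1 Y1 = ent (conv p1 p1)"
      "?K X2 Y2 = ent (conv p2 p2)" "?K X1 Y2 = ent (conv p1 p2)" "?K X2 Y1 = ent (conv p1 p2)"
      using 1 by (simp_all add: law_add_indep conv_commute[of p2 p1])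
    then show "?K X2 X1 = ent (conv p1 p2)" "?K Y1 X2 = ent (conv p1 p2)" "?K Y1 X1 = ent (conv p1 p1)"
      by (simp_all add: add.commute)
  qed
  define t where "t = sums_ent p X1 X2 Y1 Y2"
  have sums_ent: "sums_ent p X1 Y1 X2 Y2 = t" "sums_ent p X2 X1 Y1 Y2 = t" "sums_ent p Y1 X1 X2 Y2 = t" "sums_ent p X2 Y1 X1 Y2 = t"
     "sums_ent p Y1 X2 X1 Y2 = t" "sums_ent p X1 X2 Y2 Y1 = t" "sums_ent p X1 X2 Y1 Y2 = t"
    unfolding t_def using sums_ent_swap12[OF p] sums_ent_swap23[OF p] sums_ent_swap34 by metis+
  define s where "s = entropy p (\<lambda>w. X1 w + X2 w + Y1 w + Y2 w)"
  have S: "entropy p (\<lambda>w. X1 w + X2 w + Y2 w + Y1 w) = s" "entropy p (\<lambda>w. X2 w + X1 w + Y1 w + Y2 w) = s"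
    "entropy p (\<lambda>w. Y1 w + X1 w + X2 w + Y2 w) = s"
    unfolding s_def by (simp_all add: ac_simps)
  define R where "R = CC_sums p X2 X1 Y1 Y2 + CC_sums p Y1 X1 X2 Y2 + CC_sums p X1 X2 Y1 Y2 + CC_sums p Y1 X2 X1 Y2
    + CC_sums p X1 Y1 X2 Y2 + CC_sums p X2 Y1 X1 Y2"
  note CC_sums = perms[THEN CC_sums_le[OF p], unfolded l sums_ent K]
  show ?thesis
  proof (rule endgame_arith[OF \<eta> \<Phi>])
    \<comment> \<open>With the last two variables exchanged, the competitors pair unlike laws, as X1
      + Y2 and X2 + Y1; the unexchanged order used below pairs like laws, as X1 + Y1 and X2 +
      Y2.\<close>
    show "\<Phi> \<le> s - (1 + \<eta>) / 2 * (ent (conv p1 p2) + ent (conv p1 p2))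
        + \<eta> * (C p1 + ent (conv p1 p2) - ent p1 + (C p2 + ent (conv p1 p2) - ent p2))"
      using \<Phi>_le_sums[OF p i_swap34[OF i] \<eta>(1)] by (simp only: l S K)
    show "\<Phi> \<le> t - ent (conv p1 p2) - ent (conv p1 p2)
        - (1 + \<eta>) / 2 * (ent p1 + ent p2 - ent (conv p1 p2) + (ent p2 + ent p1 - ent (conv p1 p2)))
        + \<eta> * (C p1 + C p2)"
      using \<Phi>_le_fibres[OF p i_swap34[OF i] \<eta>(1)] by (simp only: l sums_ent K)
    show "\<Phi> \<le> s - (1 + \<eta>) / 2 * (ent (conv p1 p1) + ent (conv p2 p2))
        + \<eta> * (C p1 + ent (conv p1 p1) - ent p1 + (C p2 + ent (conv p2 p2) - ent p2))"
      using \<Phi>_le_sums[OF p i \<eta>(1)] by (simp only: l s_def K)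
    show "\<Phi> \<le> t - ent (conv p1 p1) - ent (conv p2 p2)
        - (1 + \<eta>) / 2 * (ent p1 + ent p1 - ent (conv p1 p1) + (ent p2 + ent p2 - ent (conv p2 p2)))
        + \<eta> * (C p1 + C p2)"
      using \<Phi>_le_fibres[OF p i \<eta>(1)] by (simp only: l sums_ent K)
    show "3 * \<Phi> \<le> (6 + \<eta>) * (4 * ent (conv p1 p2) + ent (conv p1 p1) + ent (conv p2 p2))
        - 9 * s - (9 + 3 * \<eta>) * t + \<eta> * R"
      \<comment> \<open>In these three orders X2 + Y1, X1 + Y1 and X1 + X2 each play the part of A +
        B once.\<close>
      using \<Phi>_le_triple[OF p i] \<Phi>_le_triple[OF p perms(3)] \<Phi>_le_triple[OF p perms(4)]
      unfolding sums_ent K S s_def[symmetric] R_def by (simp add: algebra_simps)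
    show "R \<le> 3 * (C p1 + C p2) - 9 / 2 * (ent p1 + ent p2) + 3 * t"
      \<comment> \<open>Over all ordered pairs of pairings the antisymmetric parts cancel; the
        constants are 24/8 = 3, 36/8 = 9/2 and 24/8 = 3.\<close>
      using CC_sums unfolding R_def by argo
  qed
qed

end

section \<open>Distributions of zero doubling and the cross entropy functional\<close>

lemma sum_conv_mult:
  "(\<Sum>z\<in>UNIV. conv m r z * f z) = (\<Sum>y\<in>UNIV. \<Sum>x\<in>UNIV. r y * (m x * f (x + y)))"
proof -
  have "(\<Sum>z\<in>UNIV. conv m r z * f z) = (\<Sum>z\<in>UNIV. \<Sum>y\<in>UNIV. r y * (m (z + y) * f z))"
    unfolding conv_commute[of m r] by (simp add: conv_def sum_distrib_right mult.assoc)
  also have "\<dots> = (\<Sum>y\<in>UNIV. \<Sum>z\<in>UNIV. r y * (m (z + y) * f z))"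
    by (rule sum.swap)
  also have "\<dots> = (\<Sum>y\<in>UNIV. \<Sum>x\<in>UNIV. r y * (m x * f (x + y)))"
  proof (rule sum.cong[OF refl])
    fix y
    show "(\<Sum>z\<in>UNIV. r y * (m (z + y) * f z)) = (\<Sum>x\<in>UNIV. r y * (m x * f (x + y)))"
      using sum_shift[of "\<lambda>x. r y * (m x * f (x + y))" y] by (simp add: add.assoc)
  qed
  finally show ?thesis .
qed

lemma pdist_obtain:
  assumes "pdist p"
  obtains x where "p x \<noteq> 0"
  using assms unfolding pdist_def by (metis sum.neutral zero_neq_one)

lemma conv_eq_0_imp:
  assumes "\<And>x. 0 \<le> p x" "\<And>x. 0 \<le> q x" "conv p q (x + y) = 0" "q y \<noteq> 0"
  shows "p x = 0"
proof -
  have "p x * q (x + y + x) = 0"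
    using assms(3) unfolding conv_def by (subst (asm) sum_nonneg_eq_0_iff) (auto simp: assms)
  then show ?thesis using assms(4) by (simp add: ac_simps)
qed

text \<open>The correction b - a makes every summand of a relative entropy nonnegative by itself,
  whatever the total masses.\<close>

lemma relative_entropy_term:
  fixes a b :: real
  assumes "0 \<le> a" "0 \<le> b" "b = 0 \<Longrightarrow> a = 0"
  shows "0 \<le> a * (ln a - ln b) - a + b" "a * (ln a - ln b) - a + b = 0 \<Longrightarrow> a = b"
proof -
  have "0 \<le> a * (ln a - ln b) - a + b \<and> (a * (ln a - ln b) - a + b = 0 \<longrightarrow> a = b)"
  proof (cases "a = 0")
    case False
    then have pos: "0 < a" "0 < b" using assms by force+
    then have "ln (b / a) \<le> b / a - 1" by (intro ln_le_minus_one) simp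
    with pos have "0 \<le> a * ((b / a - 1) - ln (b / a))" by simp
    also have eq: "\<dots> = a * (ln a - ln b) - a + b" using pos by (simp add: ln_div algebra_simps)
    finally show ?thesis
      using pos eq ln_eq_minus_one[of "b / a"] by auto
  qed (use assms in auto)
  then show "0 \<le> a * (ln a - ln b) - a + b" "a * (ln a - ln b) - a + b = 0 \<Longrightarrow> a = b" by auto
qed

text \<open>H(p * q) - H(p) is the average over y, with weights q(y), of the relative entropy of p
  to the translate by y of p * q. It vanishes only if p equals that translate for every y in the
  support of q.\<close>

lemma
  assumes p: "pdist p" and q: "pdist q"
  shows ent_le_ent_conv: "ent p \<le> ent (conv p q)"
    and ent_conv_eqD: "ent (conv p q) = ent p \<Longrightarrow> q y \<noteq> 0 \<Longrightarrow> p x = conv p q (x + y)"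
proof -
  note nn = pdist_nonneg[OF p] pdist_nonneg[OF q] pdist_nonneg[OF pdist_conv[OF p q]]
  let ?r = "conv p q"
  let ?g = "\<lambda>x y. p x * (ln (p x) - ln (?r (x + y))) - p x + ?r (x + y)"
  have g: "0 \<le> q y * ?g x y" "q y * ?g x y = 0 \<Longrightarrow> q y \<noteq> 0 \<Longrightarrow> p x = ?r (x + y)" for x y
  proof -
    have "0 \<le> q y * ?g x y \<and> (q y * ?g x y = 0 \<longrightarrow> q y \<noteq> 0 \<longrightarrow> p x = ?r (x + y))"
    proof (cases "q y = 0")
      case False
      then have "?r (x + y) = 0 \<Longrightarrow> p x = 0"
        using conv_eq_0_imp[of p q x y] nn by blast
      from relative_entropy_term[OF nn(1) nn(3) this] show ?thesis using nn(2)[of y] by auto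
    qed auto
    then show "0 \<le> q y * ?g x y" "q y * ?g x y = 0 \<Longrightarrow> q y \<noteq> 0 \<Longrightarrow> p x = ?r (x + y)" by blast+
  qed
  have sums: "sum p UNIV = 1" "sum q UNIV = 1" "sum ?r UNIV = 1"
    using p q pdist_conv[OF p q] by (auto simp: pdist_def)
  have "(\<Sum>y\<in>UNIV. \<Sum>x\<in>UNIV. q y * ?g x y) =
      (\<Sum>y\<in>UNIV. \<Sum>x\<in>UNIV. q y * (p x * ln (p x))) - (\<Sum>y\<in>UNIV. \<Sum>x\<in>UNIV. q y * (p x * ln (?r (x + y))))
      - (\<Sum>y\<in>UNIV. \<Sum>x\<in>UNIV. q y * p x) + (\<Sum>y\<in>UNIV. \<Sum>x\<in>UNIV. q y * ?r (x + y))"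
    by (simp add: algebra_simps sum.distrib sum_subtractf)
  also have "(\<Sum>y\<in>UNIV. \<Sum>x\<in>UNIV. q y * (p x * ln (p x))) = - ent p"
    by (simp add: ent_def sum_negf sums flip: sum_distrib_left sum_distrib_right)
  also have "(\<Sum>y\<in>UNIV. \<Sum>x\<in>UNIV. q y * (p x * ln (?r (x + y)))) = - ent ?r"
    by (simp add: ent_def sum_negf sum_conv_mult)
  also have "(\<Sum>y\<in>UNIV. \<Sum>x\<in>UNIV. q y * p x) = 1"
    by (simp add: sums flip: sum_distrib_left sum_distrib_right)
  also have "(\<Sum>y\<in>UNIV. \<Sum>x\<in>UNIV. q y * ?r (x + y)) = 1"
    by (simp add: sums sum_shift flip: sum_distrib_left sum_distrib_right)
  finally have eq: "(\<Sum>y\<in>UNIV. \<Sum>x\<in>UNIV. q y * ?g x y) = ent ?r - ent p" by simp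
  have "0 \<le> (\<Sum>y\<in>UNIV. \<Sum>x\<in>UNIV. q y * ?g x y)" by (intro sum_nonneg g)
  with eq show "ent p \<le> ent (conv p q)" by simp
  assume "ent (conv p q) = ent p" and y: "q y \<noteq> 0"
  with eq have "(\<Sum>y\<in>UNIV. \<Sum>x\<in>UNIV. q y * ?g x y) = 0" by simp
  then have "\<forall>y. (\<Sum>x\<in>UNIV. q y * ?g x y) = 0"
    by (subst (asm) sum_nonneg_eq_0_iff) (auto intro!: sum_nonneg g)
  then have "(\<Sum>x\<in>UNIV. q y * ?g x y) = 0" by blast
  then have "\<forall>x. q y * ?g x y = 0"
    by (subst (asm) sum_nonneg_eq_0_iff) (auto intro!: g(1))
  with g(2) y show "p x = conv p q (x + y)" by blast
qed

definition subgroup :: "'a::boolean_group set \<Rightarrow> bool"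
  where "subgroup H \<longleftrightarrow> 0 \<in> H \<and> (\<forall>x\<in>H. \<forall>y\<in>H. x + y \<in> H)"

definition coset_dist :: "'a::boolean_group set \<Rightarrow> 'a \<Rightarrow> 'a \<Rightarrow> real"
  where "coset_dist H t x = (if x + t \<in> H then 1 / card H else 0)"

lemma coset_distI:
  assumes p: "pdist p" and inv: "\<And>x. x \<in> H \<Longrightarrow> p (t + x) = p t"
    and supp: "\<And>x. p (t + x) \<noteq> 0 \<Longrightarrow> x \<in> H"
  shows "p = coset_dist H t"
proof -
  have eq: "p x = (if x + t \<in> H then p t else 0)" for x
    using inv[of "x + t"] supp[of "x + t"] by (auto simp: ac_simps)
  have "1 = (\<Sum>x\<in>UNIV. p (t + x))"
    using p by (simp add: pdist_def sum_shift')
  also have "\<dots> = (\<Sum>x\<in>UNIV. if x \<in> H then p t else 0)"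
    using inv supp by (intro sum.cong) auto
  also have "\<dots> = card H * p t" by (simp add: sum.If_cases)
  finally have "p t = 1 / card H"
    by (cases "card H = 0") (simp_all add: field_simps)
  with eq show ?thesis by (auto simp: coset_dist_def fun_eq_iff)
qed

text \<open>H(p) and H(q) are both at most H(p * q), so equality holds twice. Hence p is invariant
  under differences of points in the support of q and conversely, which makes both supports cosets
  of one group.\<close>

lemma doubling_zero_imp_coset:
  assumes p: "pdist p" and q: "pdist q" and le: "ent (conv p q) \<le> (ent p + ent q) / 2"
  obtains H s t where "subgroup H" "p = coset_dist H s" "q = coset_dist H t"
proof -
  have eq: "ent (conv p q) = ent p" "ent (conv q p) = ent q"
    using ent_le_ent_conv[OF p q] ent_le_ent_conv[OF q p] le by (simp_all add: conv_commute[of q])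
  have p_inv: "p (x + (y + y')) = p x" if "q y \<noteq> 0" "q y' \<noteq> 0" for x y y'
    using ent_conv_eqD[OF p q eq(1) that(1), of x] ent_conv_eqD[OF p q eq(1) that(2), of "x + (y + y')"]
    by (simp add: ac_simps)
  have q_inv: "q (x + (y + y')) = q x" if "p y \<noteq> 0" "p y' \<noteq> 0" for x y y'
    using ent_conv_eqD[OF q p eq(2) that(1), of x] ent_conv_eqD[OF q p eq(2) that(2), of "x + (y + y')"]
    by (simp add: ac_simps)
  obtain s where s: "p s \<noteq> 0" by (rule pdist_obtain[OF p])
  obtain t where t: "q t \<noteq> 0" by (rule pdist_obtain[OF q])
  define H where "H = {h. p (s + h) \<noteq> 0}"
  have q_H: "q (x + h) = q x" if "h \<in> H" for x h
    using q_inv[of s "s + h" x] s that by (simp add: H_def)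
  have p_H: "p (x + h) = p x" if "h \<in> H" for x h
    using p_inv[of t "t + h" x] t q_H[OF that] by simp
  have H_iff: "h \<in> H" if "q (t + h) \<noteq> 0" for h
    using p_inv[of t "t + h" s] t that s by (simp add: H_def)
  have "subgroup H"
    unfolding subgroup_def
  proof (intro conjI ballI)
    show "0 \<in> H" using s by (simp add: H_def)
    show "x + y \<in> H" if "x \<in> H" "y \<in> H" for x y
      using p_H[OF that(2), of "s + x"] that(1) by (simp add: H_def add.assoc)
  qed
  moreover have "p = coset_dist H s"
    by (rule coset_distI[OF p]) (rule p_H, assumption, simp add: H_def)
  moreover have "q = coset_dist H t"
    by (rule coset_distI[OF q]) (rule q_H, assumption, rule H_iff)
  ultimately show ?thesis by (rule that)
qed

section \<open>Cross entropy, data processing and the functional C\<close>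

definition cross_entropy :: "('a::finite \<Rightarrow> real) \<Rightarrow> ('a \<Rightarrow> real) \<Rightarrow> real"
  where "cross_entropy m q = (\<Sum>x\<in>UNIV. m x * - ln (q x))"

text \<open>Both sides are relative entropies, and independent noise does not increase them. For M =
  m * r and N = q * r the proof compares m(x) with q(x) M(x + y) / N(x + y); weighted by r(y), the
  two have the same total.\<close>

lemma cross_entropy_conv:
  assumes m: "\<And>x. 0 \<le> m x" and q: "\<And>x. 0 < q x" and r: "pdist r"
  shows "cross_entropy (conv m r) (conv q r) - ent (conv m r) \<le> cross_entropy m q - ent m"
proof -
  let ?M = "conv m r" and ?N = "conv q r"
  note r0 = pdist_nonneg[OF r]
  have M: "0 \<le> ?M z" for z using m r0 by (rule conv_nonneg)
  have N: "0 < ?N z" for z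
  proof -
    have "?N z \<noteq> 0" if "r y \<noteq> 0" for y
      using conv_eq_0_imp[of q r "z + y" y] q[of "z + y"] q r0 that
      by (auto simp: add.assoc less_imp_le less_imp_neq[symmetric])
    moreover obtain y where "r y \<noteq> 0"
      using r by (rule pdist_obtain)
    ultimately have "?N z \<noteq> 0" by blast
    then show ?thesis
      using conv_nonneg[of q r z] q r0 by (simp add: less_le)
  qed
  let ?g = "\<lambda>x y. m x * (ln (m x) - ln (q x) - ln (?M (x + y)) + ln (?N (x + y)))"
  let ?h = "\<lambda>x y. m x - q x * (?M (x + y) / ?N (x + y))"
  have le: "r y * ?h x y \<le> r y * ?g x y" for x y
  proof (cases "r y = 0")
    case False
    have "?h x y \<le> ?g x y"
    proof (cases "m x = 0")
      case True
      then show ?thesis using q[of x] M[of "x + y"] N[of "x + y"] by simp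
    next
      case m0: False
      then have "?M (x + y) \<noteq> 0" using conv_eq_0_imp[of m r x y] m r0 False by blast
      with M[of "x + y"] have Mp: "0 < ?M (x + y)" by simp
      from relative_entropy_term(1)[of "m x" "q x * (?M (x + y) / ?N (x + y))"] Mp N[of "x + y"] q[of x] m[of x]
      show ?thesis by (simp add: ln_mult ln_div algebra_simps)
    qed
    then show ?thesis using r0[of y] by (rule mult_left_mono)
  qed simp
  have 1: "(\<Sum>y\<in>UNIV. \<Sum>x\<in>UNIV. r y * f x) = sum f UNIV" for f :: "'a \<Rightarrow> real"
    using r by (simp add: pdist_def flip: sum_distrib_left sum_distrib_right)
  have "(\<Sum>y\<in>UNIV. \<Sum>x\<in>UNIV. r y * ?h x y) =
     (\<Sum>y\<in>UNIV. \<Sum>x\<in>UNIV. r y * m x) - (\<Sum>y\<in>UNIV. \<Sum>x\<in>UNIV. r y * (q x * (?M (x + y) / ?N (x + y))))"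
    by (simp add: right_diff_distrib sum_subtractf)
  also have "(\<Sum>y\<in>UNIV. \<Sum>x\<in>UNIV. r y * (q x * (?M (x + y) / ?N (x + y)))) = (\<Sum>z\<in>UNIV. ?N z * (?M z / ?N z))"
    by (rule sum_conv_mult[symmetric])
  also have "\<dots> = sum ?M UNIV" using N by (intro sum.cong) (auto simp: less_imp_neq[symmetric])
  also have "\<dots> = sum m UNIV" using r by (simp add: sum_conv pdist_def)
  finally have "(\<Sum>y\<in>UNIV. \<Sum>x\<in>UNIV. r y * ?h x y) = 0" by (simp add: 1)
  moreover have "(\<Sum>y\<in>UNIV. \<Sum>x\<in>UNIV. r y * ?h x y) \<le> (\<Sum>y\<in>UNIV. \<Sum>x\<in>UNIV. r y * ?g x y)"
    by (intro sum_mono le)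
  moreover have "(\<Sum>y\<in>UNIV. \<Sum>x\<in>UNIV. r y * ?g x y) =
      (\<Sum>y\<in>UNIV. \<Sum>x\<in>UNIV. r y * (m x * (ln (m x) - ln (q x))))
      + (\<Sum>y\<in>UNIV. \<Sum>x\<in>UNIV. r y * (m x * (ln (?N (x + y)) - ln (?M (x + y)))))"
    by (simp add: algebra_simps sum.distrib sum_subtractf)
  moreover have "\<dots> = (cross_entropy m q - ent m) - (cross_entropy ?M ?N - ent ?M)"
    by (simp add: 1 sum_conv_mult cross_entropy_def ent_def sum_negf sum_subtractf right_diff_distrib)
  ultimately show ?thesis by linarith
qed

lemma conv_assoc: "conv (conv p q) r = conv p (conv q r)"
proof
  fix x
  have "conv (conv p q) r x = (\<Sum>y\<in>UNIV. \<Sum>z\<in>UNIV. p z * q (y + z) * r (x + y))"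
    by (simp add: conv_def sum_distrib_right)
  also have "\<dots> = (\<Sum>z\<in>UNIV. \<Sum>y\<in>UNIV. p z * q (y + z) * r (x + y))" by (rule sum.swap)
  also have "\<dots> = (\<Sum>z\<in>UNIV. \<Sum>y\<in>UNIV. p z * q y * r (x + (y + z)))"
  proof (rule sum.cong[OF refl])
    fix z
    show "(\<Sum>y\<in>UNIV. p z * q (y + z) * r (x + y)) = (\<Sum>y\<in>UNIV. p z * q y * r (x + (y + z)))"
      using sum_shift[of "\<lambda>y. p z * q y * r (x + (y + z))" z] by (simp add: add.assoc)
  qed
  finally show "conv (conv p q) r x = conv p (conv q r) x"
    by (simp add: conv_def sum_distrib_left ac_simps)
qed

lemma conv_ge:
  assumes "pdist p" "\<And>x. \<theta> \<le> q x"
  shows "\<theta> \<le> conv p q x"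
proof -
  have "\<theta> = (\<Sum>y\<in>UNIV. p y * \<theta>)"
    using assms by (simp add: pdist_def flip: sum_distrib_right)
  also have "\<dots> \<le> conv p q x"
    unfolding conv_def using assms by (intro sum_mono mult_left_mono) (auto simp: pdist_def)
  finally show ?thesis .
qed

lemma pdist_le_1: "pdist p \<Longrightarrow> p x \<le> 1"
  by (metis pdist_def member_le_sum finite UNIV_I)

text \<open>The lower bound \<open>\<theta>\<close> keeps all cross entropies finite and the set of competitors compact; it is
  sent to \<open>0\<close> in the end.\<close>

definition smoothed :: "('a::boolean_group \<Rightarrow> real) \<Rightarrow> real \<Rightarrow> ('a \<Rightarrow> real) set"
  where "smoothed u \<theta> = conv u ` {r. pdist r \<and> (\<forall>x. \<theta> \<le> r x)}"

definition cross_inf :: "('a::boolean_group \<Rightarrow> real) \<Rightarrow> real \<Rightarrow> ('a \<Rightarrow> real) \<Rightarrow> real"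
  where "cross_inf u \<theta> m = (INF q\<in>smoothed u \<theta>. cross_entropy m q)"

lemma cross_entropy_nonneg:
  assumes "\<And>x. 0 \<le> m x" "pdist q" "\<And>x. 0 < q x"
  shows "0 \<le> cross_entropy m q"
  unfolding cross_entropy_def using assms pdist_le_1[OF assms(2)] by (intro sum_nonneg mult_nonneg_nonneg) auto

context
  fixes u :: "'a::boolean_group \<Rightarrow> real" and \<theta> :: real
  assumes u: "pdist u" and \<theta>: "0 < \<theta>" "\<theta> \<le> 1 / CARD('a)"
begin

lemma smoothedD:
  assumes "q \<in> smoothed u \<theta>"
  shows "pdist q" "\<theta> \<le> q x" "0 < q x"
proof -
  show "pdist q" "\<theta> \<le> q x" using assms u by (auto simp: smoothed_def pdist_conv conv_ge)
  with \<theta> show "0 < q x" by simp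
qed

lemma smoothed_nonempty: "smoothed u \<theta> \<noteq> {}"
proof -
  have "(\<lambda>_. 1 / CARD('a)) \<in> {r::'a \<Rightarrow> real. pdist r \<and> (\<forall>x. \<theta> \<le> r x)}"
    using \<theta> by (simp add: pdist_def)
  then show ?thesis unfolding smoothed_def by blast
qed

text \<open>Further noise is absorbed into the free factor. This closure lets data processing pass
  from single cross entropies to their infimum.\<close>

lemma conv_smoothed:
  assumes "q \<in> smoothed u \<theta>" and r: "pdist r"
  shows "conv q r \<in> smoothed u \<theta>"
proof -
  obtain v where v: "q = conv u v" "pdist v" "\<And>x. \<theta> \<le> v x"
    using assms by (auto simp: smoothed_def)
  have "conv q r = conv u (conv r v)" by (simp add: v conv_assoc conv_commute[of r])
  moreover have "pdist (conv r v)" "\<theta> \<le> conv r v x" for x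
    using v r by (simp_all add: pdist_conv conv_ge)
  ultimately show ?thesis by (auto simp: smoothed_def)
qed

lemma cross_entropy_bdd_below: "(\<And>x. 0 \<le> m x) \<Longrightarrow> bdd_below (cross_entropy m ` smoothed u \<theta>)"
  by (rule bdd_belowI2[of _ 0]) (auto intro!: cross_entropy_nonneg smoothedD)

lemma cross_inf_le: "(\<And>x. 0 \<le> m x) \<Longrightarrow> q \<in> smoothed u \<theta> \<Longrightarrow> cross_inf u \<theta> m \<le> cross_entropy m q"
  unfolding cross_inf_def by (rule cINF_lower[OF cross_entropy_bdd_below])

lemma cross_inf_greatest: "(\<And>q. q \<in> smoothed u \<theta> \<Longrightarrow> c \<le> cross_entropy m q) \<Longrightarrow> c \<le> cross_inf u \<theta> m"
  unfolding cross_inf_def by (rule cINF_greatest[OF smoothed_nonempty])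

text \<open>An infimum of functionals linear in m is homogeneous and superadditive; the last axiom
  combines \<open>cross_entropy_conv\<close> with \<open>conv_smoothed\<close>.\<close>

lemma conv_functional_cross_inf: "conv_functional (cross_inf u \<theta>)"
proof
  fix m :: "'a \<Rightarrow> real" and c :: real
  assume m: "\<And>x. 0 \<le> m x" and c: "0 \<le> c"
  have sc: "cross_entropy (\<lambda>x. c * m x) q = c * cross_entropy m q" for q
    by (simp add: cross_entropy_def sum_distrib_left mult.assoc)
  show "cross_inf u \<theta> (\<lambda>x. c * m x) = c * cross_inf u \<theta> m"
  proof (cases "c = 0")
    case True
    then show ?thesis using smoothed_nonempty by (simp add: cross_inf_def cross_entropy_def)
  next
    case False
    with c have c: "0 < c" by simp
    have "cross_inf u \<theta> (\<lambda>x. c * m x) / c \<le> cross_inf u \<theta> m"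
    proof (rule cross_inf_greatest)
      fix q assume "q \<in> smoothed u \<theta>"
      then have "cross_inf u \<theta> (\<lambda>x. c * m x) \<le> c * cross_entropy m q"
        using cross_inf_le[of "\<lambda>x. c * m x" q] m c by (simp add: sc)
      then show "cross_inf u \<theta> (\<lambda>x. c * m x) / c \<le> cross_entropy m q" using c by (simp add: field_simps)
    qed
    moreover have "c * cross_inf u \<theta> m \<le> cross_inf u \<theta> (\<lambda>x. c * m x)"
      by (rule cross_inf_greatest) (use cross_inf_le[of m] m c in \<open>simp add: sc\<close>)
    ultimately show ?thesis using c by (simp add: field_simps)
  qed
next
  fix m m' :: "'a \<Rightarrow> real"
  assume m: "\<And>x. 0 \<le> m x" "\<And>x. 0 \<le> m' x"
  show "cross_inf u \<theta> m + cross_inf u \<theta> m' \<le> cross_inf u \<theta> (\<lambda>x. m x + m' x)"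
  proof (rule cross_inf_greatest)
    fix q assume "q \<in> smoothed u \<theta>"
    then have "cross_inf u \<theta> m + cross_inf u \<theta> m' \<le> cross_entropy m q + cross_entropy m' q"
      by (intro add_mono cross_inf_le m)
    then show "cross_inf u \<theta> m + cross_inf u \<theta> m' \<le> cross_entropy (\<lambda>x. m x + m' x) q"
      by (simp only: cross_entropy_def distrib_right sum.distrib)
  qed
next
  fix m r :: "'a \<Rightarrow> real"
  assume m: "\<And>x. 0 \<le> m x" and r: "pdist r"
  have "cross_inf u \<theta> (conv m r) - ent (conv m r) + ent m \<le> cross_inf u \<theta> m"
  proof (rule cross_inf_greatest)
    fix q assume q: "q \<in> smoothed u \<theta>"
    have "cross_inf u \<theta> (conv m r) \<le> cross_entropy (conv m r) (conv q r)"
      by (intro cross_inf_le conv_smoothed q r conv_nonneg m pdist_nonneg[OF r])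
    with cross_entropy_conv[of m q r, OF m smoothedD(3)[OF q] r]
    show "cross_inf u \<theta> (conv m r) - ent (conv m r) + ent m \<le> cross_entropy m q" by simp
  qed
  then show "cross_inf u \<theta> (conv m r) - ent (conv m r) \<le> cross_inf u \<theta> m - ent m" by simp
qed

end

section \<open>Existence of a minimiser\<close>

lemma continuous_on_mult_ln: "continuous_on {0..} (\<lambda>x::real. x * ln x)"
proof -
  have "((\<lambda>x::real. x * ln x) \<longlongrightarrow> 0) (at 0 within {0..})"
  proof (rule Lim_null_comparison[where g = "\<lambda>x. 2 * sqrt x + x * x"])
    have "norm (x * ln x) \<le> 2 * sqrt x + x * x" if "0 < x" for x :: real
    proof -
      \<comment> \<open>The square root matters: the same inequality for 1 / x would only bound - x
        ln x by 1 - x, which does not tend to 0.\<close>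
      have "ln (1 / sqrt x) \<le> 1 / sqrt x - 1" using that by (intro ln_le_minus_one) simp
      then have "- ln x \<le> 2 / sqrt x" using that by (simp add: ln_div ln_sqrt)
      then have "x * - ln x \<le> x * (2 / sqrt x)" using that by (intro mult_left_mono) auto
      also have "\<dots> = 2 * sqrt x" using that by (simp add: field_simps real_div_sqrt)
      finally have 1: "- (x * ln x) \<le> 2 * sqrt x" by simp
      have "ln x \<le> x" using ln_le_minus_one[OF that] by simp
      then have "x * ln x \<le> x * x" using that by (intro mult_left_mono) auto
      moreover have "0 \<le> 2 * sqrt x" "0 \<le> x * x" using that by simp_all
      ultimately show ?thesis using 1 unfolding real_norm_def abs_le_iff by linarith
    qed
    then show "\<forall>\<^sub>F x in at 0 within {0..}. norm (x * ln x) \<le> 2 * sqrt x + x * x"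
      by (auto simp: eventually_at_filter intro!: always_eventually)
    have "((\<lambda>x::real. 2 * sqrt x + x * x) \<longlongrightarrow> 2 * sqrt 0 + 0 * 0) (at 0 within {0..})"
      by (intro tendsto_intros)
    then show "((\<lambda>x::real. 2 * sqrt x + x * x) \<longlongrightarrow> 0) (at 0 within {0..})" by simp
  qed
  then have "continuous (at x within {0..}) (\<lambda>x::real. x * ln x)" if "0 \<le> x" for x
    using that by (cases "x = 0") (auto simp: continuous_within intro!: tendsto_mult tendsto_ln)
  then show ?thesis by (simp add: continuous_on_eq_continuous_within)
qed

lemma continuous_on_ent:
  assumes "\<And>i. continuous_on S (\<lambda>x. f x i)" "\<And>x i. x \<in> S \<Longrightarrow> 0 \<le> f x i"
  shows "continuous_on S (\<lambda>x. ent (f x))"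
  unfolding ent_def
  by (intro continuous_intros continuous_on_compose2[OF continuous_on_mult_ln] assms)
    (use assms in auto)

lemma continuous_on_conv:
  assumes "\<And>i. continuous_on S (\<lambda>x. f x i)" "\<And>i. continuous_on S (\<lambda>x. g x i)"
  shows "continuous_on S (\<lambda>x. conv (f x) (g x) i)"
  unfolding conv_def by (intro continuous_intros assms)

lemma continuous_on_cross:
  assumes "\<And>i. continuous_on S (\<lambda>x. f x i)" "\<And>i. continuous_on S (\<lambda>x. g x i)"
    "\<And>x i. x \<in> S \<Longrightarrow> 0 < g x i"
  shows "continuous_on S (\<lambda>x. cross_entropy (f x) (g x))"
  unfolding cross_entropy_def
  by (intro continuous_intros assms ballI) (use assms(3) in \<open>auto simp: less_imp_neq[symmetric]\<close>)

lemma compact_simplex: "compact {x :: real ^ 'a. pdist (($) x) \<and> (\<forall>i. \<theta> \<le> x $ i)}"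
proof -
  have "closed ((\<Inter>i. {x :: real ^ 'a. 0 \<le> x $ i}) \<inter> {x. (\<Sum>i\<in>UNIV. x $ i) = 1} \<inter> (\<Inter>i. {x. \<theta> \<le> x $ i}))"
    by (intro closed_Int closed_INT ballI closed_Collect_le closed_Collect_eq continuous_intros)
  also have "(\<Inter>i. {x :: real ^ 'a. 0 \<le> x $ i}) \<inter> {x. (\<Sum>i\<in>UNIV. x $ i) = 1} \<inter> (\<Inter>i. {x. \<theta> \<le> x $ i})
    = {x. pdist (($) x) \<and> (\<forall>i. \<theta> \<le> x $ i)}"
    by (auto simp: pdist_def)
  finally have "closed {x :: real ^ 'a. pdist (($) x) \<and> (\<forall>i. \<theta> \<le> x $ i)}" .
  moreover have "bounded {x :: real ^ 'a. pdist (($) x) \<and> (\<forall>i. \<theta> \<le> x $ i)}"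
    unfolding bounded_iff
  proof (intro exI ballI)
    fix x :: "real ^ 'a" assume "x \<in> {x. pdist (($) x) \<and> (\<forall>i. \<theta> \<le> x $ i)}"
    then have "pdist (($) x)" by simp
    then have "(\<Sum>i\<in>UNIV. \<bar>x $ i\<bar>) = 1"
      using pdist_nonneg[of "($) x"] by (simp add: pdist_def)
    with norm_le_l1_cart[of x] show "norm x \<le> 1" by simp
  qed
  ultimately show ?thesis by (simp add: compact_eq_bounded_closed)
qed

lemma exists_minimiser:
  fixes u :: "'a::boolean_group \<Rightarrow> real"
  assumes u: "pdist u" and \<theta>: "0 < \<theta>" "\<theta> \<le> 1 / CARD('a)" and \<eta>: "0 < \<eta>"
  defines "\<phi> \<equiv> \<lambda>p q. ent (conv p q) - (1 + \<eta>) / 2 * (ent p + ent q)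
    + \<eta> * (cross_inf u \<theta> p + cross_inf u \<theta> q)"
  obtains p1 p2 where "pdist p1" "pdist p2" "\<And>q r. pdist q \<Longrightarrow> pdist r \<Longrightarrow> \<phi> p1 p2 \<le> \<phi> q r"
proof -
  define E where "E = (\<lambda>p q :: 'a \<Rightarrow> real. ent (conv p q) - (1 + \<eta>) / 2 * (ent p + ent q))"
  define S where "S = {x :: (real, 'a) vec. pdist (($) x) \<and> (\<forall>i. 0 \<le> x $ i)}"
  define R where "R = {x :: (real, 'a) vec. pdist (($) x) \<and> (\<forall>i. \<theta> \<le> x $ i)}"
  \<comment> \<open>The competitors inside the two infima become variables of their own. F is then
    continuous on a compact set, and no semicontinuity of the infimum has to be proved.\<close>
  define F where "F = (\<lambda>(x, y, v, w). E (($) x) (($) y) +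
    \<eta> * (cross_entropy (($) x) (conv u (($) v)) + cross_entropy (($) y) (conv u (($) w))))"
  have vec: "\<exists>x :: (real, 'a) vec. ($) x = f" for f
    by (rule exI[of _ "\<chi> i. f i"]) (simp add: fun_eq_iff)
  obtain x0 :: "(real, 'a) vec" where "($) x0 = (\<lambda>_. 1 / CARD('a))" using vec by blast
  then have "x0 \<in> R" using \<theta> by (simp add: R_def pdist_def)
  then have R0: "R \<noteq> {}" by blast
  have RS: "R \<subseteq> S" by (auto simp: R_def S_def pdist_def)
  have conv0: "0 < conv u (($) v) i" if "v \<in> R" for v i
    using conv_ge[OF u, of \<theta> "($) v" i] that \<theta> by (simp add: R_def)
  have "continuous_on (S \<times> S \<times> R \<times> R) F"
    unfolding F_def E_def case_prod_unfold
    by (intro continuous_intros continuous_on_ent continuous_on_conv continuous_on_cross)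
      (use conv0 in \<open>auto simp: S_def intro!: conv_nonneg\<close>)
  moreover have "compact (S \<times> S \<times> R \<times> R)"
    unfolding S_def R_def by (intro compact_Times compact_simplex)
  moreover have "S \<times> S \<times> R \<times> R \<noteq> {}" using R0 RS by auto
  ultimately obtain m where m: "m \<in> S \<times> S \<times> R \<times> R" "\<And>m'. m' \<in> S \<times> S \<times> R \<times> R \<Longrightarrow> F m \<le> F m'"
    using continuous_attains_inf by metis
  obtain x y v w where m_eq: "m = (x, y, v, w)" by (cases m)
  have mem: "pdist (($) x)" "pdist (($) y)" "conv u (($) v) \<in> smoothed u \<theta>" "conv u (($) w) \<in> smoothed u \<theta>"
    using m(1) by (auto simp: m_eq S_def R_def smoothed_def)
  note inf_le = cross_inf_le[OF u \<theta>] and inf_greatest = cross_inf_greatest[OF u \<theta>]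
  have "\<phi> (($) x) (($) y) \<le> F m"
    unfolding \<phi>_def F_def m_eq E_def using \<eta> mem
    by (auto intro!: add_mono mult_left_mono inf_le pdist_nonneg)
  moreover have "F m \<le> \<phi> q r" if q: "pdist q" and r: "pdist r" for q r
  proof -
    have "F m \<le> E q r + \<eta> * (cross_entropy q q' + cross_entropy r r')" if qr: "q' \<in> smoothed u \<theta>" "r' \<in> smoothed u \<theta>" for q' r'
    proof -
      obtain a b where ab: "q' = conv u a" "r' = conv u b" "pdist a" "pdist b" "\<And>x. \<theta> \<le> a x" "\<And>x. \<theta> \<le> b x"
        using qr by (auto simp: smoothed_def)
      obtain x' y' v' w' :: "(real, 'a) vec" where vs: "($) x' = q" "($) y' = r" "($) v' = a" "($) w' = b"
        using vec by metis
      have "(x', y', v', w') \<in> S \<times> S \<times> R \<times> R"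
        using ab q r by (auto simp: S_def R_def vs pdist_nonneg)
      from m(2)[OF this] show ?thesis by (simp add: F_def vs ab)
    qed
    \<comment> \<open>The two infima are taken one after the other, first over r' with q'
      fixed.\<close>
    then have "(F m - E q r) / \<eta> - cross_entropy q q' \<le> cross_inf u \<theta> r" if "q' \<in> smoothed u \<theta>" for q'
      using that \<eta> by (intro inf_greatest) (auto simp: field_simps)
    then have "(F m - E q r) / \<eta> - cross_inf u \<theta> r \<le> cross_inf u \<theta> q"
      by (intro inf_greatest) (auto simp: field_simps)
    then show ?thesis using \<eta> by (simp add: \<phi>_def E_def field_simps)
  qed
  ultimately show ?thesis using that[of "($) x" "($) y"] mem by (meson order.trans)
qed

section \<open>Uniform distributions: entropies and bounds for C\<close>

lemma ent_le_ln_card: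
  assumes p: "pdist p" and S: "\<And>x. p x \<noteq> 0 \<Longrightarrow> x \<in> S"
  shows "ent p \<le> ln (card S)"
proof -
  obtain x where "p x \<noteq> 0" by (rule pdist_obtain[OF p])
  then have c: "0 < real (card S)" using S by (auto simp: card_gt_0_iff)
  then have "card S \<noteq> 0" by linarith
  then have l: "ln (1 / card S) = - ln (card S)" using ln_div[of 1 "card S"] by auto
  have "0 \<le> (\<Sum>x\<in>S. p x * (ln (p x) - ln (1 / card S)) - p x + 1 / card S)"
    using c by (intro sum_nonneg relative_entropy_term(1) pdist_nonneg[OF p]) auto
  also have "\<dots> = (\<Sum>x\<in>S. p x * ln (p x)) + (\<Sum>x\<in>S. p x) * ln (card S) - (\<Sum>x\<in>S. p x) + 1"
    using \<open>card S \<noteq> 0\<close> unfolding l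
    by (simp add: distrib_left sum.distrib sum_subtractf sum_distrib_right)
  also have "(\<Sum>x\<in>S. p x * ln (p x)) = (\<Sum>x\<in>UNIV. p x * ln (p x))"
    by (rule sum.mono_neutral_left) (use S in auto)
  also have "(\<Sum>x\<in>S. p x) = (\<Sum>x\<in>UNIV. p x)"
    by (rule sum.mono_neutral_left) (use S in auto)
  finally show ?thesis using p by (simp add: pdist_def ent_def sum_negf)
qed

lemma sum_coset_dist: "(\<Sum>x\<in>UNIV. coset_dist H t x * f x) = (\<Sum>x\<in>H. f (x + t)) / card H"
proof -
  have "(\<Sum>x\<in>UNIV. coset_dist H t x * f x) = (\<Sum>x\<in>UNIV. coset_dist H t (x + t) * f (x + t))"
    by (rule sum_shift[symmetric])
  also have "\<dots> = (\<Sum>x\<in>UNIV. if x \<in> H then f (x + t) / card H else 0)"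
    by (rule sum.cong) (auto simp: coset_dist_def add.assoc)
  finally show ?thesis by (simp add: sum.If_cases sum_divide_distrib)
qed

lemma pdist_coset_dist:
  assumes "H \<noteq> {}"
  shows "pdist (coset_dist H t)"
proof -
  have "0 < card H" using assms by (simp add: card_gt_0_iff)
  then show ?thesis
    using sum_coset_dist[of H t "\<lambda>_. 1"] by (auto simp: pdist_def coset_dist_def)
qed

lemma ent_coset_dist: "H \<noteq> {} \<Longrightarrow> ent (coset_dist H t) = ln (card H)"
  using sum_coset_dist[of H t "\<lambda>x. - ln (coset_dist H t x)"] card_gt_0_iff[of H]
  by (simp add: ent_def coset_dist_def add.assoc ln_div)

lemma cross_inf_uniform_le:
  fixes A :: "'a::boolean_group set"
  assumes A: "A \<noteq> {}" and \<epsilon>: "0 < \<epsilon>" "\<epsilon> < 1"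
  shows "cross_inf (coset_dist A 0) (\<epsilon> / CARD('a)) (coset_dist A 0) \<le> ln (card A) - ln (1 - \<epsilon>)"
proof -
  let ?u = "coset_dist A 0"
  have c: "0 < card A" using A by (simp add: card_gt_0_iff)
  note u = pdist_coset_dist[OF A, of 0]
  have \<theta>: "0 < \<epsilon> / CARD('a)" "\<epsilon> / CARD('a) \<le> 1 / CARD('a)"
    using \<epsilon> by (auto simp: divide_simps)
  \<comment> \<open>Nearly the point mass at 0, for which the cross entropy would be ln |A|. The
    uniform share \<epsilon> keeps \<open>r\<close> above the required lower bound and costs at most
    - ln (1 - \<epsilon>).\<close>
  define r where "r = (\<lambda>x::'a. (if x = 0 then 1 - \<epsilon> else 0) + \<epsilon> / CARD('a))"
  have r: "pdist r" using \<epsilon> by (auto simp: pdist_def r_def sum.distrib)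
  have "conv ?u r \<in> smoothed ?u (\<epsilon> / CARD('a))"
    using r \<epsilon> by (auto simp: smoothed_def r_def)
  then have "cross_inf ?u (\<epsilon> / CARD('a)) ?u \<le> cross_entropy ?u (conv ?u r)"
    by (intro cross_inf_le[OF u \<theta>] pdist_nonneg[OF u])
  also have "\<dots> = (\<Sum>x\<in>A. - ln (conv ?u r x)) / card A"
    unfolding cross_entropy_def sum_coset_dist by simp
  also have "\<dots> \<le> (\<Sum>x\<in>A. ln (card A) - ln (1 - \<epsilon>)) / card A"
  proof (intro divide_right_mono sum_mono)
    fix x assume x: "x \<in> A"
    have "?u x * r (x + x) \<le> conv ?u r x"
      unfolding conv_def using u r by (intro member_le_sum) (auto simp: pdist_nonneg)
    moreover have "(1 - \<epsilon>) / card A \<le> ?u x * r (x + x)"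
      using x \<epsilon> c by (simp add: coset_dist_def r_def divide_simps)
    ultimately have "ln ((1 - \<epsilon>) / card A) \<le> ln (conv ?u r x)"
      using \<epsilon> c by (intro ln_mono) auto
    then show "- ln (conv ?u r x) \<le> ln (card A) - ln (1 - \<epsilon>)"
      using \<epsilon> A by (simp add: ln_div)
  qed simp
  finally show ?thesis using A by simp
qed

text \<open>A translate of \<open>A\<close> meets a coset of \<open>H\<close> in at most
  \<open>M\<close> points, so every competitor gives the coset mass at most M / |A|. By concavity of
  the logarithm the mean of - ln q over its |H| points is then at least ln (|H| |A| / M).\<close>

lemma cross_inf_coset_ge:
  fixes A H :: "'a::boolean_group set"
  assumes A: "A \<noteq> {}" and H: "H \<noteq> {}" and \<theta>: "0 < \<theta>" "\<theta> \<le> 1 / CARD('a)"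
    and M: "\<And>t. card {x \<in> A. x + t \<in> H} \<le> M" "0 < M"
  shows "ln (card H) + ln (card A) - ln M \<le> cross_inf (coset_dist A 0) \<theta> (coset_dist H s)"
proof (rule cross_inf_greatest[OF pdist_coset_dist[OF A] \<theta>])
  fix q assume q: "q \<in> smoothed (coset_dist A 0) \<theta>"
  then obtain r where r: "q = conv (coset_dist A 0) r" "pdist r" by (auto simp: smoothed_def)
  have q0: "0 < q x" for x by (rule smoothedD(3)[OF pdist_coset_dist[OF A] \<theta> q])
  have c: "0 < card A" "0 < card H" using A H by (auto simp: card_gt_0_iff)
  let ?P = "\<Sum>x\<in>H. q (x + s)"
  have P0: "0 < ?P" using q0 H by (intro sum_pos) auto
  have "?P = (\<Sum>x\<in>H. \<Sum>y\<in>UNIV. r y * coset_dist A 0 (x + s + y))"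
    unfolding r(1) conv_commute[of _ r] conv_def ..
  also have "\<dots> = (\<Sum>y\<in>UNIV. r y * (\<Sum>x\<in>H. coset_dist A 0 (x + s + y)))"
    by (subst sum.swap) (simp add: sum_distrib_left)
  also have "\<dots> \<le> (\<Sum>y\<in>UNIV. r y * (M / card A))"
  proof (intro sum_mono mult_left_mono pdist_nonneg[OF r(2)])
    fix y
    have "(\<Sum>x\<in>H. coset_dist A 0 (x + s + y)) = card {x \<in> H. x + s + y \<in> A} / card A"
      by (simp add: coset_dist_def sum.If_cases Int_def)
    also have "card {x \<in> H. x + s + y \<in> A} = card {x \<in> A. x + (s + y) \<in> H}"
      by (rule bij_betw_same_card[of "\<lambda>x. x + (s + y)"], rule bij_betwI[where g = "\<lambda>x. x + (s + y)"])
        (auto simp: ac_simps)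
    also have "\<dots> / card A \<le> M / card A"
      using M(1)[of "s + y"] by (intro divide_right_mono) auto
    finally show "(\<Sum>x\<in>H. coset_dist A 0 (x + s + y)) \<le> M / card A" .
  qed
  also have "\<dots> = M / card A" using r(2) by (simp only: sum_distrib_right[symmetric]) (simp add: pdist_def)
  finally have PM: "?P \<le> M / card A" .
  have "(\<Sum>x\<in>H. ln (q (x + s)) + ln (card H) - ln ?P) \<le> (\<Sum>x\<in>H. q (x + s) * card H / ?P - 1)"
  proof (rule sum_mono)
    fix x
    have "ln (q (x + s) * card H / ?P) \<le> q (x + s) * card H / ?P - 1"
      using q0 P0 c by (intro ln_le_minus_one) simp
    then show "ln (q (x + s)) + ln (card H) - ln ?P \<le> q (x + s) * card H / ?P - 1"
      using q0[of "x + s"] P0 H by (simp add: ln_mult ln_div)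
  qed
  also have "\<dots> = 0"
    using P0 by (simp add: sum_subtractf flip: sum_divide_distrib sum_distrib_right)
  finally have "(\<Sum>x\<in>H. ln (q (x + s))) \<le> (ln ?P - ln (card H)) * card H"
    by (simp add: sum.distrib sum_subtractf algebra_simps)
  moreover have "0 < real (card H)" using c by linarith
  ultimately have "(\<Sum>x\<in>H. ln (q (x + s))) / card H \<le> ln ?P - ln (card H)"
    by (simp only: pos_divide_le_eq)
  also have "ln ?P \<le> ln (M / card A)" using P0 PM by (intro ln_mono) auto
  also have "\<dots> = ln M - ln (card A)" using M(2) A by (simp add: ln_div)
  finally show "ln (card H) + ln (card A) - ln M \<le> cross_entropy (coset_dist H s) q"
    unfolding cross_entropy_def sum_coset_dist by (simp add: sum_negf)
qed

section \<open>Passing from entropy to covering\<close>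

lemma subgroup_nonempty: "subgroup H \<Longrightarrow> H \<noteq> {}"
  by (auto simp: subgroup_def)

lemma approximating_subgroup:
  fixes A :: "'a::boolean_group set" and K :: real
  assumes A: "A \<noteq> {}" and K: "real (card (A + A)) \<le> K * card A" and \<epsilon>: "0 < \<epsilon>" "\<epsilon> < 1"
  shows "\<exists>H. subgroup H \<and> (\<forall>M. (\<forall>t. card {x \<in> A. x + t \<in> H} \<le> M) \<longrightarrow> 0 < M \<longrightarrow>
      ln (card H) + ln (card A) - 2 * ln M \<le> 8 / (1 - \<epsilon>) * ln K - 2 * ln (1 - \<epsilon>))"
proof -
  \<comment> \<open>As \<epsilon> tends to 0, \<eta> increases to 1/8 and \<theta> decreases to 0,
    so one parameter governs both limits.\<close>
  define \<eta> where "\<eta> = (1 - \<epsilon>) / 8"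
  define \<theta> where "\<theta> = \<epsilon> / CARD('a)"
  have \<eta>: "0 < \<eta>" "\<eta> < 1 / 8" using \<epsilon> by (auto simp: \<eta>_def)
  have \<theta>: "0 < \<theta>" "\<theta> \<le> 1 / CARD('a)" using \<epsilon> by (auto simp: \<theta>_def divide_simps)
  define u where "u = coset_dist A 0"
  have u: "pdist u" unfolding u_def by (rule pdist_coset_dist[OF A])
  obtain p1 p2 where p: "pdist p1" "pdist p2" and min: "\<And>q r. pdist q \<Longrightarrow> pdist r \<Longrightarrow>
      ent (conv p1 p2) - (1 + \<eta>) / 2 * (ent p1 + ent p2) + \<eta> * (cross_inf u \<theta> p1 + cross_inf u \<theta> p2) \<le>
      ent (conv q r) - (1 + \<eta>) / 2 * (ent q + ent r) + \<eta> * (cross_inf u \<theta> q + cross_inf u \<theta> r)"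
    using exists_minimiser[OF u \<theta> \<eta>(1)] by blast
  define \<Phi> where "\<Phi> = ent (conv p1 p2) - (1 + \<eta>) / 2 * (ent p1 + ent p2)
    + \<eta> * (cross_inf u \<theta> p1 + cross_inf u \<theta> p2)"
  interpret conv_functional "cross_inf u \<theta>" by (rule conv_functional_cross_inf[OF u \<theta>])
  interpret minimal_value "cross_inf u \<theta>" \<eta> \<Phi>
    by unfold_locales (unfold \<Phi>_def, rule min)
  have zero: "ent (conv p1 p2) \<le> (ent p1 + ent p2) / 2"
    using doubling_zero[OF p less_imp_le[OF \<eta>(1)] \<eta>(2) \<Phi>_def] .
  obtain H s t where H: "subgroup H" and p_eq: "p1 = coset_dist H s" "p2 = coset_dist H t"
    by (rule doubling_zero_imp_coset[OF p zero])
  note H0 = subgroup_nonempty[OF H]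
  have ent_u: "ent u = ln (card A)" unfolding u_def by (rule ent_coset_dist[OF A])
  have cA: "0 < real (card A)" using A by (simp add: card_gt_0_iff)
  have "A + A \<noteq> {}" using A by (auto simp: set_plus_def)
  then have cAA: "0 < real (card (A + A))" by (simp add: card_gt_0_iff)
  with K cA have K0: "0 < K" by (smt (verit) zero_less_mult_pos2)
  have "ent (conv u u) \<le> ln (card (A + A))"
  proof (rule ent_le_ln_card[OF pdist_conv[OF u u]])
    fix x assume "conv u u x \<noteq> 0"
    then obtain y where "u y * u (x + y) \<noteq> 0" unfolding conv_def by (meson sum.neutral)
    then have "y \<in> A" "x + y \<in> A" by (auto simp: u_def coset_dist_def split: if_splits)
    then have "y + (x + y) \<in> A + A" by (rule set_plus_intro)
    then show "x \<in> A + A" by (simp add: ac_simps)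
  qed
  also have "\<dots> \<le> ln (K * card A)" using K cAA by (intro ln_mono) auto
  also have "\<dots> = ln K + ln (card A)" using K0 cA by (rule ln_mult_pos)
  finally have conv_u: "ent (conv u u) \<le> ln K + ln (card A)" .
  have C_u: "cross_inf u \<theta> u \<le> ln (card A) - ln (1 - \<epsilon>)"
    unfolding u_def \<theta>_def by (rule cross_inf_uniform_le[OF A \<epsilon>])
  have conv_p: "ln (card H) \<le> ent (conv p1 p2)"
    using ent_le_ent_conv[OF p] ent_coset_dist[OF H0] by (simp add: p_eq)
  show ?thesis
  proof (intro exI[of _ H] conjI H allI impI)
    fix M :: nat
    assume "\<forall>t. card {x \<in> A. x + t \<in> H} \<le> M" and M0: "0 < M"
    then have M: "card {x \<in> A. x + t \<in> H} \<le> M" for t by blast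
    define L where "L = ln (card H) + ln (card A) - ln M"
    have L: "L \<le> cross_inf u \<theta> p1" "L \<le> cross_inf u \<theta> p2"
      unfolding L_def p_eq u_def by (intro cross_inf_coset_ge A H0 \<theta> M M0)+
    \<comment> \<open>The left side equals \<eta> (2 L - ln |H|), while the value at (u, u) is at
      most ln K + \<eta> ln |A| - 2 \<eta> ln (1 - \<epsilon>); hence division by \<eta> produces
      the factor 8 / (1 - \<epsilon>).\<close>
    have "ln (card H) - (1 + \<eta>) / 2 * (ln (card H) + ln (card H)) + \<eta> * (L + L) \<le> \<Phi>"
      unfolding \<Phi>_def using conv_p L \<eta> ent_coset_dist[OF H0]
      by (auto simp: p_eq intro!: add_mono mult_left_mono)
    also have "\<dots> \<le> ent (conv u u) - (1 + \<eta>) / 2 * (ent u + ent u) + \<eta> * (cross_inf u \<theta> u + cross_inf u \<theta> u)"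
      by (rule \<Phi>_le[OF u u])
    also have "\<dots> \<le> (ln K + ln (card A)) - (1 + \<eta>) / 2 * (ln (card A) + ln (card A))
        + \<eta> * ((ln (card A) - ln (1 - \<epsilon>)) + (ln (card A) - ln (1 - \<epsilon>)))"
      unfolding ent_u using \<eta> conv_u C_u by (intro add_mono diff_mono mult_left_mono) auto
    finally have "\<eta> * (ln (card H) + ln (card A) - 2 * ln M + 2 * ln (1 - \<epsilon>)) \<le> ln K"
      unfolding L_def by (simp add: field_simps)
    then have "ln (card H) + ln (card A) - 2 * ln M + 2 * ln (1 - \<epsilon>) \<le> ln K / \<eta>"
      using \<eta>(1) by (simp add: pos_le_divide_eq mult.commute)
    also have "ln K / \<eta> = 8 / (1 - \<epsilon>) * ln K" by (simp add: \<eta>_def)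
    finally show "ln (card H) + ln (card A) - 2 * ln M \<le> 8 / (1 - \<epsilon>) * ln K - 2 * ln (1 - \<epsilon>)" by simp
  qed
qed

text \<open>The subgroup of \<open>approximating_subgroup\<close> depends on \<epsilon>, but the
  left side of its bound, as a function of the subgroup, does not. A minimiser of it among the
  finitely many subgroups obeys the bound for all \<epsilon>, so the limit can be taken.\<close>

lemma exists_subgroup_large_intersection:
  fixes A :: "'a::boolean_group set" and K :: real
  assumes A: "A \<noteq> {}" and K: "real (card (A + A)) \<le> K * card A" and K0: "0 < K"
  obtains H t where "subgroup H" "card H * card A \<le> K ^ 8 * (card {x \<in> A. x + t \<in> H})\<^sup>2"
proof -
  define M where "M H = Max (range (\<lambda>t. card {x \<in> A. x + t \<in> H}))" for H
  define f where "f H = ln (card H) + ln (card A) - 2 * ln (M H)" for H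
  have M_ge: "card {x \<in> A. x + t \<in> H} \<le> M H" for t H unfolding M_def by (rule Max_ge) auto
  have M_pos: "0 < M H" if "subgroup H" for H
  proof -
    obtain a where "a \<in> A" using A by blast
    with that have "a \<in> {x \<in> A. x + a \<in> H}" by (simp add: subgroup_def)
    then have "0 < card {x \<in> A. x + a \<in> H}" by (auto simp: card_gt_0_iff)
    with M_ge[of a H] show ?thesis by simp
  qed
  have "subgroup {0::'a}" by (simp add: subgroup_def)
  then have "f ` {H. subgroup H} \<noteq> {}" by blast
  then have "Min (f ` {H. subgroup H}) \<in> f ` {H. subgroup H}" by (intro Min_in) auto
  then obtain H where H: "subgroup H" and fH: "Min (f ` {H. subgroup H}) = f H" by blast
  have H_min: "f H \<le> f H'" if "subgroup H'" for H'
    unfolding fH[symmetric] using that by (intro Min_le) auto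
  have "f H \<le> 8 / (1 - \<epsilon>) * ln K - 2 * ln (1 - \<epsilon>)" if \<epsilon>: "0 < \<epsilon>" "\<epsilon> < 1" for \<epsilon>
  proof -
    obtain H' where H': "subgroup H'" and *: "\<forall>M. (\<forall>t. card {x \<in> A. x + t \<in> H'} \<le> M) \<longrightarrow> 0 < M \<longrightarrow>
        ln (card H') + ln (card A) - 2 * ln M \<le> 8 / (1 - \<epsilon>) * ln K - 2 * ln (1 - \<epsilon>)"
      using approximating_subgroup[OF A K \<epsilon>] by (elim exE conjE)
    have "f H' \<le> 8 / (1 - \<epsilon>) * ln K - 2 * ln (1 - \<epsilon>)"
      unfolding f_def by (intro *[rule_format] M_ge M_pos H')
    with H_min[OF H'] show ?thesis by linarith
  qed
  then have ev: "\<forall>\<^sub>F \<epsilon> in at_right 0. f H \<le> 8 / (1 - \<epsilon>) * ln K - 2 * ln (1 - \<epsilon>)"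
    unfolding eventually_at_right_field by (intro exI[of _ 1]) auto
  have "((\<lambda>\<epsilon>. 8 / (1 - \<epsilon>) * ln K - 2 * ln (1 - \<epsilon>)) \<longlongrightarrow> 8 / (1 - 0) * ln K - 2 * ln (1 - 0)) (at_right (0::real))"
    by (intro tendsto_intros) auto
  from tendsto_lowerbound[OF this ev] have f: "f H \<le> 8 * ln K" by simp
  have "M H \<in> range (\<lambda>t. card {x \<in> A. x + t \<in> H})" unfolding M_def by (rule Max_in) auto
  then obtain t where t: "M H = card {x \<in> A. x + t \<in> H}" by blast
  have pos: "0 < real (card H)" "0 < real (card A)" "0 < real (M H)"
    using A subgroup_nonempty[OF H] M_pos[OF H] by (simp_all add: card_gt_0_iff)
  have "ln (real (card H) * real (card A)) \<le> ln (K ^ 8 * real (M H) ^ 2)"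
    using f pos K0 by (simp add: f_def ln_mult_pos ln_realpow)
  moreover have "0 < K ^ 8 * real (M H) ^ 2" using pos K0 by simp
  ultimately have "real (card H) * real (card A) \<le> K ^ 8 * real (M H) ^ 2"
    using pos by (subst (asm) ln_le_cancel_iff) auto
  then show ?thesis using that[OF H, of t] by (simp add: t)
qed

section \<open>Cosets, covering and subgroups of prescribed size\<close>

definition coset :: "'a::boolean_group set \<Rightarrow> 'a \<Rightarrow> 'a set"
  where "coset V x = {y. y + x \<in> V}"

lemma coset_eq_iff:
  assumes "subgroup V"
  shows "coset V x = coset V y \<longleftrightarrow> x + y \<in> V"
proof
  assume "coset V x = coset V y"
  moreover have "x \<in> coset V x" using assms by (simp add: coset_def subgroup_def)
  ultimately show "x + y \<in> V" by (auto simp: coset_def)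
next
  assume xy: "x + y \<in> V"
  have "z + x \<in> V \<longleftrightarrow> z + y \<in> V" for z
  proof -
    have "(z + x) + (x + y) = z + y" "(z + y) + (x + y) = z + x" by (simp_all add: ac_simps)
    with xy assms show ?thesis unfolding subgroup_def by metis
  qed
  then show "coset V x = coset V y" by (simp add: coset_def)
qed

lemma card_coset: "card (coset V x) = card V"
  by (rule bij_betw_same_card[of "\<lambda>y. y + x"], rule bij_betwI[where g = "\<lambda>y. y + x"])
    (auto simp: coset_def add.assoc)

lemma coset_disjoint:
  assumes "subgroup V" "coset V x \<noteq> coset V y"
  shows "coset V x \<inter> coset V y = {}"
proof (rule ccontr)
  assume "coset V x \<inter> coset V y \<noteq> {}"
  then obtain z where "z + x \<in> V" "z + y \<in> V" by (auto simp: coset_def)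
  then have "(z + x) + (z + y) \<in> V" using assms(1) by (simp add: subgroup_def)
  then have "x + y \<in> V" by (simp add: ac_simps)
  with assms show False by (simp add: coset_eq_iff)
qed

lemma card_Union_cosets:
  assumes "subgroup V"
  shows "card V * card (coset V ` A) = card (\<Union>(coset V ` A))"
proof (rule card_partition)
  fix c d assume "c \<in> coset V ` A" "d \<in> coset V ` A" "c \<noteq> d"
  then show "c \<inter> d = {}" using coset_disjoint[OF assms] by auto
qed (auto simp: card_coset)

text \<open>Ruzsa's covering argument, where no maximal packing is needed: translates of a subset of one
  coset of \<open>H\<close> by elements of distinct cosets of \<open>H\<close> are automatically disjoint.\<close>

lemma card_cosets_mult_le:
  assumes H: "subgroup H"
  shows "card (coset H ` A) * card {x \<in> A. x + t \<in> H} \<le> card (A + A)"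
proof -
  let ?B = "{x \<in> A. x + t \<in> H}"
  define rep where "rep = inv_into A (coset H)"
  have rep: "rep c \<in> A" "coset H (rep c) = c" if "c \<in> coset H ` A" for c
    unfolding rep_def by (rule inv_into_into[OF that], rule f_inv_into_f[OF that])
  let ?g = "\<lambda>(c, b). rep c + b"
  have "inj_on ?g (coset H ` A \<times> ?B)"
  proof (rule inj_onI, clarify)
    fix x b x' b'
    assume x: "x \<in> A" "x' \<in> A" and b: "b + t \<in> H" "b' + t \<in> H"
      and eq: "rep (coset H x) + b = rep (coset H x') + b'"
    have "rep (coset H x) + rep (coset H x') = b + b'"
      using eq by (metis add.commute add.left_commute add_self_left)
    also have "\<dots> = (b + t) + (b' + t)" by (simp add: ac_simps)
    also have "\<dots> \<in> H" using b H by (simp add: subgroup_def)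
    finally have "coset H (rep (coset H x)) = coset H (rep (coset H x'))"
      by (simp add: coset_eq_iff[OF H])
    then have "coset H x = coset H x'" using rep x by simp
    with eq show "coset H x = coset H x' \<and> b = b'" by simp
  qed
  then have "card (coset H ` A \<times> ?B) \<le> card (A + A)"
    by (rule card_inj_on_le) (auto intro: rep(1))
  then show ?thesis by (simp add: card_cartesian_product)
qed

text \<open>Adjoining one more element of \<open>H\<close> doubles a subgroup, so a largest one with
  at most n elements has more than n / 2.\<close>

lemma exists_subgroup_of_size:
  assumes H: "subgroup H" and n: "0 < n" "n < card H"
  obtains V where "subgroup V" "V \<subseteq> H" "card V \<le> n" "n < 2 * card V"
proof -
  let ?P = "\<lambda>V. subgroup V \<and> V \<subseteq> H \<and> card V \<le> n"
  have P0: "?P {0}" using H n by (auto simp: subgroup_def)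
  have "\<exists>V. ?P V \<and> (\<forall>W. ?P W \<longrightarrow> card W \<le> card V)"
    by (rule ex_has_greatest_nat[of ?P "{0}" card "Suc n", OF P0]) simp
  then obtain V where V: "?P V" and max: "\<forall>W. ?P W \<longrightarrow> card W \<le> card V" by (elim exE conjE) simp
  have "V \<noteq> H" using V n by auto
  then obtain g where g: "g \<in> H" "g \<notin> V" using V by blast
  define W where "W = V \<union> coset V g"
  have "0 \<in> V" using V by (auto simp: subgroup_def)
  have add: "x + y \<in> V" if "x \<in> V" "y \<in> V" for x y using V that by (simp add: subgroup_def)
  have "subgroup W"
    unfolding subgroup_def
  proof (intro conjI ballI)
    show "0 \<in> W" using \<open>0 \<in> V\<close> by (simp add: W_def)
    fix x y assume "x \<in> W" "y \<in> W"
    then show "x + y \<in> W"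
      using add[of x y] add[of "x + g" y] add[of x "y + g"] add[of "x + g" "y + g"]
      by (auto simp: W_def coset_def ac_simps)
  qed
  moreover have "W \<subseteq> H"
  proof
    fix x assume "x \<in> W"
    then consider "x \<in> V" | "x + g \<in> V" by (auto simp: W_def coset_def)
    then show "x \<in> H"
    proof cases
      case 2
      then have "(x + g) + g \<in> H" using V g H by (auto simp: subgroup_def)
      then show ?thesis by (simp add: ac_simps)
    qed (use V in auto)
  qed
  moreover have "card W = 2 * card V"
  proof -
    have "V \<inter> coset V g = {}"
    proof (rule ccontr)
      assume "V \<inter> coset V g \<noteq> {}"
      then obtain x where "x \<in> V" "x + g \<in> V" by (auto simp: coset_def)
      from add[OF this] g show False by simp
    qed
    then show ?thesis by (simp add: W_def card_Un_disjoint card_coset)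
  qed
  moreover have "0 < card V" using \<open>0 \<in> V\<close> by (auto simp: card_gt_0_iff)
  ultimately have "n < 2 * card V" using max[rule_format, of W] by (cases "card W \<le> n") auto
  with V show ?thesis using that by blast
qed

lemma card_cosets_le:
  fixes A :: "'a::boolean_group set" and K :: real
  assumes A: "A \<noteq> {}" and K: "real (card (A + A)) \<le> K * card A"
  obtains V where "subgroup V" "card V \<le> card A" "real (card (coset V ` A)) \<le> 2 * K ^ 9"
proof -
  have cA: "0 < real (card A)" using A by (simp add: card_gt_0_iff)
  have "A + A \<noteq> {}" using A by (auto simp: set_plus_def)
  then have "0 < real (card (A + A))" by (simp add: card_gt_0_iff)
  with K cA have K0: "0 < K" by (smt (verit) zero_less_mult_pos2)
  obtain H t where H: "subgroup H" and HA: "card H * card A \<le> K ^ 8 * (card {x \<in> A. x + t \<in> H})\<^sup>2"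
    using exists_subgroup_large_intersection[OF A K K0] by blast
  define h a m where "h = real (card H)" and "a = real (card A)" and "m = real (card {x \<in> A. x + t \<in> H})"
  have h: "0 < h" using subgroup_nonempty[OF H] by (simp add: h_def card_gt_0_iff)
  have a: "0 < a" using cA by (simp add: a_def)
  have ha: "h * a \<le> K ^ 8 * m\<^sup>2" using HA by (simp add: h_def a_def m_def)
  have ma: "m \<le> a" unfolding m_def a_def by (simp add: card_mono)
  have mh: "m \<le> h"
  proof -
    have "{x \<in> A. x + t \<in> H} \<subseteq> coset H t" by (auto simp: coset_def)
    then show ?thesis using card_mono[of "coset H t"] by (simp add: m_def h_def card_coset)
  qed
  have m0: "0 \<le> m" by (simp add: m_def)
  \<comment> \<open>Volume count: the cosets of \<open>V\<close> that meet \<open>A\<close> lie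
    inside the cosets of \<open>H\<close> that meet \<open>A\<close>, and the number of the latter
    is bounded by \<open>card_cosets_mult_le\<close>.\<close>
  have cover: "card V * real (card (coset V ` A)) * m \<le> h * (K * a)" if V: "subgroup V" "V \<subseteq> H" for V
  proof -
    have "\<Union>(coset V ` A) \<subseteq> \<Union>(coset H ` A)" using V(2) by (auto simp: coset_def)
    then have "card (\<Union>(coset V ` A)) \<le> card (\<Union>(coset H ` A))" by (intro card_mono) auto
    then have "card V * card (coset V ` A) \<le> card H * card (coset H ` A)"
      using card_Union_cosets[OF H, of A] card_Union_cosets[OF V(1), of A] by simp
    then have "real (card V) * real (card (coset V ` A)) \<le> h * real (card (coset H ` A))"
      unfolding h_def by (simp flip: of_nat_mult)
    then have "card V * real (card (coset V ` A)) * m \<le> h * real (card (coset H ` A)) * m"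
      using m0 by (intro mult_right_mono) auto
    also have "\<dots> = h * (real (card (coset H ` A)) * m)" by simp
    also have "\<dots> \<le> h * (K * a)"
    proof (rule mult_left_mono)
      have "real (card (coset H ` A)) * m \<le> real (card (A + A))"
        using card_cosets_mult_le[OF H, of A t] unfolding m_def by (simp flip: of_nat_mult)
      with K show "real (card (coset H ` A)) * m \<le> K * a" by (simp add: a_def)
    qed (use h in simp)
    finally show ?thesis .
  qed
  show ?thesis
  proof (cases "card H \<le> card A")
    case True
    define T where "T = real (card (coset H ` A))"
    have T0: "0 \<le> T" by (simp add: T_def)
    have "h * (T * m) \<le> h * (K * a)" using cover[OF H subset_refl] by (simp add: h_def T_def mult.assoc)
    then have Tm: "T * m \<le> K * a" using h by simp
    have "h * a \<le> K ^ 8 * h\<^sup>2"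
      using ha mh m0 K0 by (meson mult_left_mono order.trans power_mono zero_le_power less_imp_le)
    then have ah: "a \<le> K ^ 8 * h" using h by (simp add: power2_eq_square mult.left_commute)
    \<comment> \<open>Squares avoid square roots: K^18 consists of K^8 from the intersection, K^2
      from the covering and K^8 from \<open>ah\<close>.\<close>
    have "T\<^sup>2 * (h * a) \<le> T\<^sup>2 * (K ^ 8 * m\<^sup>2)" using ha by (intro mult_left_mono) auto
    also have "\<dots> = K ^ 8 * (T * m)\<^sup>2" by (simp add: power_mult_distrib)
    also have "\<dots> \<le> K ^ 8 * (K * a)\<^sup>2"
      using Tm T0 m0 K0 by (intro mult_left_mono power_mono) auto
    also have "\<dots> = K ^ 10 * a * a" by (simp add: power_mult_distrib power2_eq_square eval_nat_numeral)
    also have "\<dots> \<le> K ^ 10 * (K ^ 8 * h) * a" using ah a K0 by (intro mult_right_mono mult_left_mono) auto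
    finally have "T\<^sup>2 * (h * a) \<le> (K ^ 9)\<^sup>2 * (h * a)" by (simp add: mult_ac flip: power_add power_mult)
    then have "T\<^sup>2 \<le> (K ^ 9)\<^sup>2" using h a by simp
    then have "T \<le> K ^ 9" by (rule power2_le_imp_le) (use K0 in simp)
    then have "T \<le> 2 * K ^ 9" using K0 by (simp add: order.trans[of T "K ^ 9"])
    then show ?thesis using that[OF H True] by (simp add: T_def)
  next
    case False
    then obtain V where V: "subgroup V" "V \<subseteq> H" "card V \<le> card A" "card A < 2 * card V"
      using exists_subgroup_of_size[OF H, of "card A"] cA by auto
    define T where "T = real (card (coset V ` A))"
    have T0: "0 \<le> T" by (simp add: T_def)
    have aV: "a \<le> 2 * real (card V)" using V(4) unfolding a_def by linarith
    have "a * (T * m) \<le> 2 * real (card V) * (T * m)" using aV T0 m0 by (intro mult_right_mono) auto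
    also have "\<dots> \<le> 2 * (h * (K * a))" using cover[OF V(1,2)] by (simp add: T_def mult.assoc)
    finally have "a * (T * m) \<le> a * (2 * K * h)" by (simp add: mult_ac)
    then have Tm: "T * m \<le> 2 * K * h" using a by simp
    \<comment> \<open>The mirror image of the first case: now m \<le> a bounds |H| by K^8
      |A|.\<close>
    have "h * a \<le> K ^ 8 * a\<^sup>2"
      using ha ma m0 K0 by (meson mult_left_mono order.trans power_mono zero_le_power less_imp_le)
    then have hK: "h \<le> K ^ 8 * a" using a by (simp add: power2_eq_square)
    have "T\<^sup>2 * (h * a) \<le> T\<^sup>2 * (K ^ 8 * m\<^sup>2)" using ha by (intro mult_left_mono) auto
    also have "\<dots> = K ^ 8 * (T * m)\<^sup>2" by (simp add: power_mult_distrib)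
    also have "\<dots> \<le> K ^ 8 * (2 * K * h)\<^sup>2"
      using Tm T0 m0 K0 by (intro mult_left_mono power_mono) auto
    also have "\<dots> = 4 * K ^ 10 * h * h" by (simp add: power_mult_distrib power2_eq_square eval_nat_numeral)
    also have "\<dots> \<le> 4 * K ^ 10 * h * (K ^ 8 * a)" using hK h K0 by (intro mult_left_mono) auto
    finally have "T\<^sup>2 * (h * a) \<le> (2 * K ^ 9)\<^sup>2 * (h * a)"
      by (simp add: mult_ac power_mult_distrib flip: power_add power_mult)
    then have "T\<^sup>2 \<le> (2 * K ^ 9)\<^sup>2" using h a by simp
    then have "T \<le> 2 * K ^ 9" by (rule power2_le_imp_le) (use K0 in simp)
    then show ?thesis using that[OF V(1,3)] by (simp add: T_def)
  qed
qed

lemma is_translate_coset: "is_translate V (coset V x)"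
proof -
  have "coset V x = {v + x |v. v \<in> V}"
    by (force simp: coset_def add.assoc)
  then show ?thesis unfolding is_translate_def by blast
qed

text \<open>The only scalars are 0 and 1, so closure under addition already gives linearity.\<close>

lemma subspace_subgroup:
  fixes V :: "(bit ^ 'n::finite) set"
  assumes "subgroup V"
  shows "vec.subspace V"
  unfolding vec.subspace_def
proof (intro conjI ballI allI)
  fix c :: bit and x assume "x \<in> V"
  then show "c *s x \<in> V" using assms by (cases c) (auto simp: subgroup_def)
qed (use assms in \<open>auto simp: subgroup_def\<close>)

theorem theorem1p2:
  fixes A :: "(bit ^ 'n::finite) set" and K :: real
  assumes "A \<noteq> {}"
    and "real (card (A + A)) \<le> K * real (card A)"
  shows "\<exists>V. vec.subspace V \<and> card V \<le> card A \<and>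
    (\<exists>\<T>. finite \<T> \<and> (\<forall>W\<in>\<T>. is_translate V W) \<and>
         real (card \<T>) \<le> 2 * K ^ 9 \<and> A \<subseteq> \<Union>\<T>)"
proof -
  obtain V where V: "subgroup V" "card V \<le> card A" "real (card (coset V ` A)) \<le> 2 * K ^ 9"
    by (rule card_cosets_le[OF assms])
  moreover have "A \<subseteq> \<Union>(coset V ` A)"
    using V(1) by (auto simp: coset_def subgroup_def)
  ultimately show ?thesis
    using subspace_subgroup[OF V(1)] is_translate_coset
    by (intro exI[of _ V] conjI exI[of _ "coset V ` A"]) auto
qed

end
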